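(* Let $I=(0,1)$. Let $U_x(s)$ and $U_y(t)$ ($s,t\in\mathbb{R}$) be unitary one-parameter groups on $L^2(I\times I)$ generated by self-adjoint extensions of $\frac1i\frac{\partial}{\partial x}$ and $\frac1i\frac{\partial}{\partial y}$, respectively, on $C_c^\infty(I^2)$, with respective boundary unitaries $U_2$ (on $L^2(I_y)$) and $V_1$ (on $L^2(I_x)$). Suppose that the two groups commute, i.e. $U_x(s)U_y(t)=U_y(t)U_x(s)$ for all $s,t\in\mathbb{R}$. Then: (i) Either $U_2$ is of the form $aI_{L^2(I_y)}$ for a scalar $a$, or else $V_1$ commutes with periodic translation in the $x$-variable. (ii) Either $V_1$ is of the form $bI_{L^2(I_x)}$ for some scalar $b$, or else $U_2$ commutes with periodic translation in the $y$-variable. (iii) In case $U_2=e^{i2\pi\alpha}I_{L^2(I_y)}$ (with $\alpha\in\mathbb{R}$), then $$U_x(s)(e_{\alpha+m}\otimes g)=e^{i2\pi(\alpha+m)s}\,e_{\alpha+m}\otimes g$$ for all $s\in\mathbb{R}$, $m\in\mathbb{Z}$ and $g\in L^2(I_y)$. (iv) In case $V_1=e^{i2\pi\beta}I_{L^2(I_x)}$ (with $\beta\in\mathbb{R}$), then $$U_y(t)(f\otimes e_{\beta+n})=e^{i2\pi(\beta+n)t}\,f\otimes e_{\beta+n}$$ for all $t\in\mathbb{R}$, $f\in L^2(I_x)$ and $n\in\mathbb{Z}$.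
   Context: $L^2(I\times I)=L^2(I_x)\otimes L^2(I_y)$, where $I_x,I_y$ denote the interval $I$ in the first and second variable; $e_\xi(x)=e^{i2\pi\xi x}$ restricted to $I$. Boundary unitaries: if $H$ is a self-adjoint extension of $\frac1i\frac{\partial}{\partial x}$ on $C_c^\infty(I^2)\subset L^2(I^2)$, there is a unique unitary $U_2$ on $L^2(I_y)$ such that the domain of $H$ is determined by the boundary condition $f(1,\cdot)=U_2(f(0,\cdot))$; the group $U_x(s)=\exp(isH)$ is obtained by extending $f\in L^2(I_x,L^2(I_y))$ to $x\in\mathbb{R}$ by $f(x+1)=U_2(f(x))$ and setting $(U_x(s)f)(x)=f(x+s)$. Likewise, with the roles of the variables exchanged, $U_y(t)$ is given by a unitary $V_1$ on $L^2(I_x)$ via the boundary condition $f(\cdot,1)=V_1(f(\cdot,0))$. Periodic translation in $L^2(I)$ is the group of translations modulo $1$; to commute with periodic translation means to commute with all of these operators. *)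

theory Defs
  imports "HOL-Analysis.Analysis"
begin

text \<open>
  Elements of \<open>L\<^sup>2(M)\<close> are represented by square-integrable functions, and equality in
  \<open>L\<^sup>2(M)\<close> is equality almost everywhere.  Bounded operators are maps on representatives that
  respect this equality; unbounded operators are given by their graphs, which are closed under
  change of representatives.
\<close>

definition L2 :: "'a measure \<Rightarrow> ('a \<Rightarrow> complex) set" where
  "L2 M = {f \<in> borel_measurable M. integrable M (\<lambda>x. (cmod (f x))\<^sup>2)}"

definition L2_eq :: "'a measure \<Rightarrow> ('a \<Rightarrow> complex) \<Rightarrow> ('a \<Rightarrow> complex) \<Rightarrow> bool" where
  "L2_eq M f g \<longleftrightarrow> (AE x in M. f x = g x)"

definition L2_inner :: "'a measure \<Rightarrow> ('a \<Rightarrow> complex) \<Rightarrow> ('a \<Rightarrow> complex) \<Rightarrow> complex" where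
  "L2_inner M f g = (LINT x|M. f x * cnj (g x))"

definition L2_norm :: "'a measure \<Rightarrow> ('a \<Rightarrow> complex) \<Rightarrow> real" where
  "L2_norm M f = sqrt (LINT x|M. (cmod (f x))\<^sup>2)"

definition L2_unitary :: "'a measure \<Rightarrow> (('a \<Rightarrow> complex) \<Rightarrow> ('a \<Rightarrow> complex)) \<Rightarrow> bool" where
  "L2_unitary M T \<longleftrightarrow>
     (\<forall>f\<in>L2 M. T f \<in> L2 M) \<and>
     (\<forall>f\<in>L2 M. \<forall>g\<in>L2 M. L2_eq M f g \<longrightarrow> L2_eq M (T f) (T g)) \<and>
     (\<forall>f\<in>L2 M. \<forall>g\<in>L2 M. \<forall>a b.
        L2_eq M (T (\<lambda>x. a * f x + b * g x)) (\<lambda>x. a * T f x + b * T g x)) \<and>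
     (\<forall>f\<in>L2 M. \<forall>g\<in>L2 M. L2_inner M (T f) (T g) = L2_inner M f g) \<and>
     (\<forall>g\<in>L2 M. \<exists>f\<in>L2 M. L2_eq M (T f) g)"

type_synonym 'a L2_graph = "(('a \<Rightarrow> complex) \<times> ('a \<Rightarrow> complex)) set"

definition L2_dense :: "'a measure \<Rightarrow> ('a \<Rightarrow> complex) set \<Rightarrow> bool" where
  "L2_dense M D \<longleftrightarrow> D \<subseteq> L2 M \<and> (\<forall>f\<in>L2 M. \<forall>\<epsilon>>0. \<exists>g\<in>D. L2_norm M (\<lambda>x. f x - g x) < \<epsilon>)"

definition L2_operator :: "'a measure \<Rightarrow> 'a L2_graph \<Rightarrow> bool" where
  "L2_operator M G \<longleftrightarrow>
     G \<subseteq> L2 M \<times> L2 M \<and>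
     L2_dense M (Domain G) \<and>
     (\<forall>f g f' g' a b. (f, g) \<in> G \<longrightarrow> (f', g') \<in> G \<longrightarrow>
        (\<lambda>x. a * f x + b * f' x, \<lambda>x. a * g x + b * g' x) \<in> G) \<and>
     (\<forall>f g f' g'. (f, g) \<in> G \<longrightarrow> (f', g') \<in> G \<longrightarrow> L2_eq M f f' \<longrightarrow> L2_eq M g g') \<and>
     (\<forall>f g. \<forall>f'\<in>L2 M. \<forall>g'\<in>L2 M.
        (f, g) \<in> G \<longrightarrow> L2_eq M f f' \<longrightarrow> L2_eq M g g' \<longrightarrow> (f', g') \<in> G)"

definition L2_adjoint :: "'a measure \<Rightarrow> 'a L2_graph \<Rightarrow> 'a L2_graph" where
  "L2_adjoint M G =
     {(u, v). u \<in> L2 M \<and> v \<in> L2 M \<and> (\<forall>(f, g)\<in>G. L2_inner M g u = L2_inner M f v)}"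

definition self_adjoint :: "'a measure \<Rightarrow> 'a L2_graph \<Rightarrow> bool" where
  "self_adjoint M G \<longleftrightarrow> L2_operator M G \<and> L2_adjoint M G = G"

definition unitary_group ::
  "'a measure \<Rightarrow> (real \<Rightarrow> ('a \<Rightarrow> complex) \<Rightarrow> ('a \<Rightarrow> complex)) \<Rightarrow> bool" where
  "unitary_group M U \<longleftrightarrow>
     (\<forall>s. L2_unitary M (U s)) \<and>
     (\<forall>f\<in>L2 M. L2_eq M (U 0 f) f) \<and>
     (\<forall>s t. \<forall>f\<in>L2 M. L2_eq M (U (s + t) f) (U s (U t f))) \<and>
     (\<forall>f\<in>L2 M. \<forall>t. ((\<lambda>s. L2_norm M (\<lambda>x. U s f x - U t f x)) \<longlongrightarrow> 0) (at t))"

text \<open>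
  With the factor \<open>1/i\<close>, the unitary group \<open>U\<close> with generator \<open>H\<close> is \<open>U(s) = exp(isH)\<close>
  (Stone's theorem).
\<close>

definition generator ::
  "'a measure \<Rightarrow> (real \<Rightarrow> ('a \<Rightarrow> complex) \<Rightarrow> ('a \<Rightarrow> complex)) \<Rightarrow> 'a L2_graph" where
  "generator M U =
     {(f, g). f \<in> L2 M \<and> g \<in> L2 M \<and>
       ((\<lambda>s. L2_norm M (\<lambda>x. (U s f x - f x) / (\<i> * of_real s) - g x)) \<longlongrightarrow> 0) (at 0)}"

definition interval_M :: "real measure" where
  "interval_M = restrict_space lborel {0<..<1}"

definition square_M :: "(real \<times> real) measure" where
  "square_M = interval_M \<Otimes>\<^sub>M interval_M"

primrec C_k :: "nat \<Rightarrow> ('a::real_normed_vector \<Rightarrow> 'b::real_normed_vector) \<Rightarrow> bool" where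
  "C_k 0 f \<longleftrightarrow> continuous_on UNIV f"
| "C_k (Suc k) f \<longleftrightarrow>
     (\<forall>p. f differentiable (at p)) \<and> (\<forall>v. C_k k (\<lambda>p. frechet_derivative f (at p) v))"

text \<open>\<open>C\<^sub>c\<^sup>\<infinity>(I\<^sup>2)\<close>, each function being extended by zero to the whole plane.\<close>

definition test_functions :: "(real \<times> real \<Rightarrow> complex) set" where
  "test_functions =
     {\<phi>. (\<forall>k. C_k k \<phi>) \<and>
         (\<exists>K. compact K \<and> K \<subseteq> {0<..<1} \<times> {0<..<1} \<and> (\<forall>p. p \<notin> K \<longrightarrow> \<phi> p = 0))}"

text \<open>
  The operator \<open>1/i\<close> times the derivative in direction \<open>v\<close>, with domain \<open>C\<^sub>c\<^sup>\<infinity>(I\<^sup>2)\<close>; the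
  directions \<open>(1, 0)\<close> and \<open>(0, 1)\<close> give the partial derivatives in \<open>x\<close> and \<open>y\<close>.
\<close>

definition min_momentum :: "real \<times> real \<Rightarrow> (real \<times> real) L2_graph" where
  "min_momentum v =
     {(f, g). f \<in> L2 square_M \<and> g \<in> L2 square_M \<and>
       (\<exists>\<phi>\<in>test_functions. L2_eq square_M f \<phi> \<and>
          L2_eq square_M g (\<lambda>p. (1 / \<i>) * frechet_derivative \<phi> (at p) v))}"

text \<open>The adjoint of the minimal operator: the maximal operator, acting as a weak derivative.\<close>

definition max_momentum :: "real \<times> real \<Rightarrow> (real \<times> real) L2_graph" where
  "max_momentum v = L2_adjoint square_M (min_momentum v)"

definition self_adjoint_extension :: "real \<times> real \<Rightarrow> (real \<times> real) L2_graph \<Rightarrow> bool" where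
  "self_adjoint_extension v H \<longleftrightarrow> self_adjoint square_M H \<and> min_momentum v \<subseteq> H"

text \<open>
  \<open>F t\<close> is the slice, at \<open>t\<close>, of a function on the square, as a function of the other variable.
  Its boundary values \<open>u = F 0\<close> and \<open>w = F 1\<close> are those of the representative that is continuous
  from \<open>[0,1]\<close> to \<open>L\<^sup>2(I)\<close>; such a representative exists whenever the function lies in the domain
  of the maximal operator in the direction of \<open>t\<close>.
\<close>

definition has_boundary_values ::
  "(real \<Rightarrow> real \<Rightarrow> complex) \<Rightarrow> (real \<Rightarrow> complex) \<Rightarrow> (real \<Rightarrow> complex) \<Rightarrow> bool" where
  "has_boundary_values F u w \<longleftrightarrow>
     (\<exists>G. (\<forall>t\<in>{0..1}. G t \<in> L2 interval_M) \<and>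
          (\<forall>t\<in>{0..1}. ((\<lambda>s. L2_norm interval_M (\<lambda>z. G s z - G t z)) \<longlongrightarrow> 0) (at t within {0..1})) \<and>
          (AE t in interval_M. L2_eq interval_M (G t) (F t)) \<and>
          G 0 = u \<and> G 1 = w)"

text \<open>The domain of \<open>H\<close> is determined by \<open>f(1,\<cdot>) = U\<^sub>2(f(0,\<cdot>))\<close>.\<close>

definition boundary_unitary_x ::
  "(real \<times> real) L2_graph \<Rightarrow> ((real \<Rightarrow> complex) \<Rightarrow> (real \<Rightarrow> complex)) \<Rightarrow> bool" where
  "boundary_unitary_x H U2 \<longleftrightarrow>
     L2_unitary interval_M U2 \<and>
     Domain H = {f \<in> Domain (max_momentum (1, 0)).
       \<exists>u w. has_boundary_values (\<lambda>x y. f (x, y)) u w \<and> L2_eq interval_M w (U2 u)}"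

text \<open>The domain of \<open>H\<close> is determined by \<open>f(\<cdot>,1) = V\<^sub>1(f(\<cdot>,0))\<close>.\<close>

definition boundary_unitary_y ::
  "(real \<times> real) L2_graph \<Rightarrow> ((real \<Rightarrow> complex) \<Rightarrow> (real \<Rightarrow> complex)) \<Rightarrow> bool" where
  "boundary_unitary_y H V1 \<longleftrightarrow>
     L2_unitary interval_M V1 \<and>
     Domain H = {f \<in> Domain (max_momentum (0, 1)).
       \<exists>u w. has_boundary_values (\<lambda>y x. f (x, y)) u w \<and> L2_eq interval_M w (V1 u)}"

definition scalar_operator :: "((real \<Rightarrow> complex) \<Rightarrow> (real \<Rightarrow> complex)) \<Rightarrow> complex \<Rightarrow> bool" where
  "scalar_operator T a \<longleftrightarrow> (\<forall>f\<in>L2 interval_M. L2_eq interval_M (T f) (\<lambda>x. a * f x))"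

definition periodic_translation :: "real \<Rightarrow> (real \<Rightarrow> complex) \<Rightarrow> (real \<Rightarrow> complex)" where
  "periodic_translation t f = (\<lambda>x. f (frac (x + t)))"

definition commutes_periodic_translation ::
  "((real \<Rightarrow> complex) \<Rightarrow> (real \<Rightarrow> complex)) \<Rightarrow> bool" where
  "commutes_periodic_translation T \<longleftrightarrow>
     (\<forall>t. \<forall>f\<in>L2 interval_M.
        L2_eq interval_M (T (periodic_translation t f)) (periodic_translation t (T f)))"

definition e :: "real \<Rightarrow> real \<Rightarrow> complex" where
  "e \<xi> x = exp (\<i> * of_real (2 * pi * \<xi> * x))"

definition tensor :: "(real \<Rightarrow> complex) \<Rightarrow> (real \<Rightarrow> complex) \<Rightarrow> real \<times> real \<Rightarrow> complex" where
  "tensor f g = (\<lambda>(x, y). f x * g y)"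

end

theory Submission
  imports Defs
begin

text \<open>
  On elementary tensors and for \<open>0 \<le> s \<le> 1\<close> the group \<open>U\<^sub>x(s)\<close> is
  \<open>S\<^sub>s \<otimes> I + S\<^sub>s\<^sub>-\<^sub>1 \<otimes> U\<^sub>2\<close>, where \<open>S\<^sub>s\<close> translates by \<open>s\<close> and cuts off outside the interval.
  For smooth compactly supported first factors the right-hand side is a differentiable curve
  in the domain of the generator which solves the evolution equation; such a curve is the orbit
  because the group is isometric, and a density argument gives all tensors.  In particular
  \<open>U\<^sub>y(1) = V\<^sub>1 \<otimes> I\<close>, so that commutation with \<open>U\<^sub>x(s)\<close> reads
  \<open>[V\<^sub>1, S\<^sub>s] \<otimes> I + [V\<^sub>1, S\<^sub>s\<^sub>-\<^sub>1] \<otimes> U\<^sub>2 = 0\<close>.  Unless \<open>U\<^sub>2\<close> is a scalar, both commutators vanish,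
  and the periodic translation is \<open>S\<^sub>s + S\<^sub>s\<^sub>-\<^sub>1\<close>.
\<close>

subsection \<open>The space \<open>L\<^sup>2(M)\<close>\<close>

text \<open>The hypotheses describe a group only through its generator, and the generator only
  through the boundary values on its domain. Traces are therefore computed for explicit curves
  alone. Three facts make such a curve an orbit: integration by parts puts it into the maximal
  domain; test functions separate the points of L^2, so the extension acts on it as the maximal
  operator does; and its distance to the orbit has derivative zero.

  The dichotomy rests on the fact that the two commutators do not see the second tensor factor: a
  nonzero value of the second one, used as a functional, yields the same proportionality factor
  between \<open>U2 g\<close> and \<open>g\<close> for every \<open>g\<close>.

  For (iii) and (iv) the tensor formula is evaluated at an exponential, whose wrapped and unwrapped
  pieces fit together because its growth over one period is the boundary scalar. The group law then
  leads from times in [0,1] to all times. Since everything is stated up to a coordinate flip, each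
  argument serves both groups.\<close>

lemma L2_measurable [measurable_dest]: "f \<in> L2 M \<Longrightarrow> f \<in> borel_measurable M"
  by (simp add: L2_def)

lemma L2_integrable_square: "f \<in> L2 M \<Longrightarrow> integrable M (\<lambda>x. (cmod (f x))\<^sup>2)"
  by (simp add: L2_def)

lemma L2_dominated:
  assumes f: "f \<in> borel_measurable M" and g: "integrable M g"
    and le: "\<And>x. x \<in> space M \<Longrightarrow> (cmod (f x))\<^sup>2 \<le> g x"
  shows "f \<in> L2 M"
proof -
  have "integrable M (\<lambda>x. (cmod (f x))\<^sup>2)"
    by (rule Bochner_Integration.integrable_bound[OF g]) (use f le in \<open>auto intro!: order_trans[OF le] simp: AE_I2\<close>)
  with f show ?thesis by (simp add: L2_def)
qed

lemma L2_scale [intro]: "f \<in> L2 M \<Longrightarrow> (\<lambda>x. c * f x) \<in> L2 M"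
  by (auto simp: L2_def norm_mult power_mult_distrib)

lemma L2_add [intro]:
  assumes "f \<in> L2 M" "g \<in> L2 M"
  shows "(\<lambda>x. f x + g x) \<in> L2 M"
proof (rule L2_dominated[where g = "\<lambda>x. 2 * (cmod (f x))\<^sup>2 + 2 * (cmod (g x))\<^sup>2"])
  show "(\<lambda>x. f x + g x) \<in> borel_measurable M"
    using assms by (auto simp: L2_def)
  show "integrable M (\<lambda>x. 2 * (cmod (f x))\<^sup>2 + 2 * (cmod (g x))\<^sup>2)"
    using assms by (auto simp: L2_def)
  fix x
  have "(cmod (f x + g x))\<^sup>2 \<le> (cmod (f x) + cmod (g x))\<^sup>2"
    by (intro power_mono norm_triangle_ineq) simp
  also have "\<dots> \<le> 2 * (cmod (f x))\<^sup>2 + 2 * (cmod (g x))\<^sup>2"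
    using sum_squares_bound[of "cmod (f x)" "cmod (g x)"] by (simp add: power2_sum)
  finally show "(cmod (f x + g x))\<^sup>2 \<le> 2 * (cmod (f x))\<^sup>2 + 2 * (cmod (g x))\<^sup>2" .
qed

lemma L2_diff [intro]: "f \<in> L2 M \<Longrightarrow> g \<in> L2 M \<Longrightarrow> (\<lambda>x. f x - g x) \<in> L2 M"
  using L2_add[of f M "\<lambda>x. (-1) * g x"] L2_scale[of g M "-1"] by simp

lemma L2_norm_nonneg [simp]: "0 \<le> L2_norm M f"
  by (simp add: L2_norm_def)

lemma L2_norm_power2: "(L2_norm M f)\<^sup>2 = (LINT x|M. (cmod (f x))\<^sup>2)"
  by (simp add: L2_norm_def)

lemma L2_norm_cong_AE:
  assumes "f \<in> borel_measurable M" "g \<in> borel_measurable M" "L2_eq M f g"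
  shows "L2_norm M f = L2_norm M g"
  unfolding L2_norm_def
  by (rule arg_cong[of _ _ sqrt], rule integral_cong_AE) (use assms in \<open>auto simp: L2_eq_def\<close>)

lemma L2_norm_scale: "L2_norm M (\<lambda>x. c * f x) = cmod c * L2_norm M f"
  by (simp add: L2_norm_def norm_mult power_mult_distrib real_sqrt_mult)

lemma L2_norm_minus_commute: "L2_norm M (\<lambda>x. f x - g x) = L2_norm M (\<lambda>x. g x - f x)"
  by (simp add: L2_norm_def norm_minus_commute)

lemma L2_norm_eq_0_imp:
  assumes "f \<in> L2 M" "L2_norm M f = 0"
  shows "L2_eq M f (\<lambda>_. 0)"
proof -
  have "(LINT x|M. (cmod (f x))\<^sup>2) = 0"
    using assms(2) by (simp add: L2_norm_def)
  then have "AE x in M. (cmod (f x))\<^sup>2 = 0"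
    using integral_nonneg_eq_0_iff_AE[OF L2_integrable_square[OF assms(1)]] by simp
  then show ?thesis by (simp add: L2_eq_def)
qed

lemma L2_eq_if_norm_diff_0:
  assumes "f \<in> L2 M" "g \<in> L2 M" "L2_norm M (\<lambda>x. f x - g x) = 0"
  shows "L2_eq M f g"
  using L2_norm_eq_0_imp[OF L2_diff[OF assms(1,2)] assms(3)] by (simp add: L2_eq_def)

lemma L2_integrable_mult:
  assumes f: "f \<in> L2 M" and g: "g \<in> L2 M"
  shows "integrable M (\<lambda>x. f x * g x)"
proof (rule Bochner_Integration.integrable_bound)
  show "integrable M (\<lambda>x. (cmod (f x))\<^sup>2 + (cmod (g x))\<^sup>2)"
    using assms by (auto simp: L2_def)
  show "(\<lambda>x. f x * g x) \<in> borel_measurable M"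
    using assms by (auto simp: L2_def)
  have "cmod (f x) * cmod (g x) \<le> (cmod (f x))\<^sup>2 + (cmod (g x))\<^sup>2" for x
    using sum_squares_bound[of "cmod (f x)" "cmod (g x)"]
      mult_nonneg_nonneg[OF norm_ge_zero norm_ge_zero, of "f x" "g x"]
    unfolding mult.assoc by linarith
  then show "AE x in M. norm (f x * g x) \<le> norm ((cmod (f x))\<^sup>2 + (cmod (g x))\<^sup>2)"
    by (simp add: norm_mult)
qed

lemma L2_cnj [intro]: "f \<in> L2 M \<Longrightarrow> (\<lambda>x. cnj (f x)) \<in> L2 M"
proof -
  assume f: "f \<in> L2 M"
  have "(\<lambda>x. cnj (f x)) \<in> borel_measurable M"
    by (rule borel_measurable_continuous_on[where f = cnj])
      (use f in \<open>auto intro!: continuous_intros simp: L2_def\<close>)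
  then show ?thesis using f by (simp add: L2_def)
qed

lemma L2_inner_integrable: "f \<in> L2 M \<Longrightarrow> g \<in> L2 M \<Longrightarrow> integrable M (\<lambda>x. f x * cnj (g x))"
  by (intro L2_integrable_mult L2_cnj)

text \<open>Weighted AM-GM, 2ab \<le> t a^2 + b^2/t, is integrated and then optimised: t =
  \<open>?B / ?A\<close> minimises the right-hand side. The degenerate case of a vanishing norm is
  separate because this t must be positive.\<close>

lemma L2_integral_norm_mult_le:
  assumes f: "f \<in> L2 M" and g: "g \<in> L2 M"
  shows "(LINT x|M. cmod (f x) * cmod (g x)) \<le> L2_norm M f * L2_norm M g"
proof -
  let ?I = "LINT x|M. cmod (f x) * cmod (g x)"
  let ?A = "L2_norm M f" and ?B = "L2_norm M g"
  have int: "integrable M (\<lambda>x. cmod (f x) * cmod (g x))"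
    using integrable_norm[OF L2_integrable_mult[OF f g]] by (simp add: norm_mult)
  have key: "2 * ?I \<le> t * ?A\<^sup>2 + ?B\<^sup>2 / t" if t: "t > 0" for t
  proof -
    have "(LINT x|M. 2 * (cmod (f x) * cmod (g x))) \<le> (LINT x|M. t * (cmod (f x))\<^sup>2 + (cmod (g x))\<^sup>2 / t)"
    proof (rule integral_mono)
      fix x
      have "0 \<le> (t * cmod (f x) - cmod (g x))\<^sup>2 / t" using t by simp
      also have "\<dots> = t * (cmod (f x))\<^sup>2 + (cmod (g x))\<^sup>2 / t - 2 * (cmod (f x) * cmod (g x))"
        using t by (simp add: power2_eq_square field_simps)
      finally show "2 * (cmod (f x) * cmod (g x)) \<le> t * (cmod (f x))\<^sup>2 + (cmod (g x))\<^sup>2 / t" by simp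
    qed (use int L2_integrable_square[OF f] L2_integrable_square[OF g] in auto)
    then show ?thesis
      using L2_integrable_square[OF f] L2_integrable_square[OF g] by (simp add: L2_norm_power2)
  qed
  show ?thesis
  proof (cases "?A = 0 \<or> ?B = 0")
    case True
    then have "AE x in M. cmod (f x) * cmod (g x) = 0"
      using L2_norm_eq_0_imp[OF f] L2_norm_eq_0_imp[OF g] by (auto simp: L2_eq_def elim!: AE_mp)
    then have "?I = 0"
      by (intro integral_eq_zero_AE)
    then show ?thesis by simp
  next
    case False
    then have pos: "?A > 0" "?B > 0" using L2_norm_nonneg by (metis less_eq_real_def)+
    have "2 * ?I \<le> (?B / ?A) * ?A\<^sup>2 + ?B\<^sup>2 / (?B / ?A)" using pos by (intro key) simp
    also have "\<dots> = 2 * (?A * ?B)" using pos by (simp add: power2_eq_square)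
    finally show ?thesis by simp
  qed
qed

lemma L2_Cauchy_Schwarz:
  assumes f: "f \<in> L2 M" and g: "g \<in> L2 M"
  shows "cmod (L2_inner M f g) \<le> L2_norm M f * L2_norm M g"
proof -
  have "cmod (L2_inner M f g) \<le> (LINT x|M. cmod (f x * cnj (g x)))"
    unfolding L2_inner_def by (rule integral_norm_bound)
  also have "\<dots> \<le> L2_norm M f * L2_norm M g"
    using L2_integral_norm_mult_le[OF f g] by (simp add: norm_mult)
  finally show ?thesis .
qed

lemma L2_norm_triangle:
  assumes f: "f \<in> L2 M" and g: "g \<in> L2 M"
  shows "L2_norm M (\<lambda>x. f x + g x) \<le> L2_norm M f + L2_norm M g"
proof (rule power2_le_imp_le)
  have int: "integrable M (\<lambda>x. cmod (f x) * cmod (g x))"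
    using integrable_norm[OF L2_integrable_mult[OF f g]] by (simp add: norm_mult)
  have "(L2_norm M (\<lambda>x. f x + g x))\<^sup>2 \<le> (LINT x|M. (cmod (f x))\<^sup>2 + (cmod (g x))\<^sup>2 + 2 * (cmod (f x) * cmod (g x)))"
    unfolding L2_norm_power2
  proof (rule integral_mono)
    fix x
    have "(cmod (f x + g x))\<^sup>2 \<le> (cmod (f x) + cmod (g x))\<^sup>2"
      by (intro power_mono norm_triangle_ineq) simp
    then show "(cmod (f x + g x))\<^sup>2 \<le> (cmod (f x))\<^sup>2 + (cmod (g x))\<^sup>2 + 2 * (cmod (f x) * cmod (g x))"
      by (simp add: power2_sum)
  qed (use int L2_integrable_square[OF f] L2_integrable_square[OF g] L2_integrable_square[OF L2_add[OF f g]] in auto)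
  also have "\<dots> = (L2_norm M f)\<^sup>2 + (L2_norm M g)\<^sup>2 + 2 * (LINT x|M. cmod (f x) * cmod (g x))"
    using int L2_integrable_square[OF f] L2_integrable_square[OF g] by (simp add: L2_norm_power2)
  also have "\<dots> \<le> (L2_norm M f + L2_norm M g)\<^sup>2"
    using L2_integral_norm_mult_le[OF f g] by (simp add: power2_sum)
  finally show "(L2_norm M (\<lambda>x. f x + g x))\<^sup>2 \<le> (L2_norm M f + L2_norm M g)\<^sup>2" .
qed simp

lemma L2_norm_triangle_diff:
  assumes "f \<in> L2 M" "g \<in> L2 M" "h \<in> L2 M"
  shows "L2_norm M (\<lambda>x. f x - h x) \<le> L2_norm M (\<lambda>x. f x - g x) + L2_norm M (\<lambda>x. g x - h x)"
  using L2_norm_triangle[OF L2_diff[OF assms(1,2)] L2_diff[OF assms(2,3)]] by simp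

lemma L2_norm_le_dominated:
  assumes "f \<in> L2 M" "g \<in> L2 M" and le: "\<And>x. x \<in> space M \<Longrightarrow> cmod (f x) \<le> cmod (g x)"
  shows "L2_norm M f \<le> L2_norm M g"
  unfolding L2_norm_def
  by (intro real_sqrt_le_mono integral_mono)
    (use assms in \<open>auto intro: L2_integrable_square power_mono\<close>)

lemma L2_inner_self: "L2_inner M f f = of_real ((L2_norm M f)\<^sup>2)"
  by (simp add: L2_norm_power2 L2_inner_def flip: complex_norm_square integral_complex_of_real)

lemma L2_eq_refl: "L2_eq M f f"
  by (simp add: L2_eq_def)

lemma L2_eq_sym: "L2_eq M f g \<Longrightarrow> L2_eq M g f"
  by (auto simp: L2_eq_def elim!: AE_mp)

lemma L2_eq_trans: "L2_eq M f g \<Longrightarrow> L2_eq M g h \<Longrightarrow> L2_eq M f h"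
  unfolding L2_eq_def by (erule (1) eventually_elim2) simp

lemma L2_eq_lincomb:
  "L2_eq M f f' \<Longrightarrow> L2_eq M g g' \<Longrightarrow> L2_eq M (\<lambda>x. a * f x + b * g x) (\<lambda>x. a * f' x + b * g' x)"
  unfolding L2_eq_def by (erule (1) eventually_elim2) simp

text \<open>The closing step of the density arguments: norm convergence does not give pointwise
  limits, so equality almost everywhere is recovered from the norm of the difference.\<close>

lemma L2_eq_limit:
  assumes "\<And>n. F n \<in> L2 M" "\<And>n. G n \<in> L2 M" "f \<in> L2 M" "g \<in> L2 M"
    and "\<And>n. L2_eq M (F n) (G n)"
    and "(\<lambda>n. L2_norm M (\<lambda>x. F n x - f x)) \<longlonglongrightarrow> 0"
    and "(\<lambda>n. L2_norm M (\<lambda>x. G n x - g x)) \<longlonglongrightarrow> 0"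
  shows "L2_eq M f g"
proof -
  have "L2_norm M (\<lambda>x. f x - g x) \<le> L2_norm M (\<lambda>x. F n x - f x) + L2_norm M (\<lambda>x. G n x - g x)" for n
  proof -
    have "L2_norm M (\<lambda>x. F n x - g x) = L2_norm M (\<lambda>x. G n x - g x)"
      by (rule L2_norm_cong_AE[OF L2_measurable[OF L2_diff[OF assms(1,4)]]
            L2_measurable[OF L2_diff[OF assms(2,4)]]])
        (use assms(5)[of n] in \<open>auto simp: L2_eq_def elim: AE_mp\<close>)
    then show ?thesis
      using L2_norm_triangle_diff[OF assms(3) assms(1) assms(4), of n] L2_norm_minus_commute[of M f "F n"]
      by simp
  qed
  moreover have "(\<lambda>n. L2_norm M (\<lambda>x. F n x - f x) + L2_norm M (\<lambda>x. G n x - g x)) \<longlonglongrightarrow> 0"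
    using tendsto_add[OF assms(6,7)] by simp
  ultimately have "L2_norm M (\<lambda>x. f x - g x) \<le> 0"
    by (intro LIMSEQ_le_const[of _ 0]) auto
  then show ?thesis
    using L2_eq_if_norm_diff_0[OF assms(3,4)] L2_norm_nonneg by (metis order_antisym)
qed

lemma L2_unitary_closed: "L2_unitary M T \<Longrightarrow> f \<in> L2 M \<Longrightarrow> T f \<in> L2 M"
  by (simp add: L2_unitary_def)

lemma L2_unitary_cong:
  "L2_unitary M T \<Longrightarrow> f \<in> L2 M \<Longrightarrow> g \<in> L2 M \<Longrightarrow> L2_eq M f g \<Longrightarrow> L2_eq M (T f) (T g)"
  by (simp add: L2_unitary_def)

lemma L2_unitary_linear:
  "L2_unitary M T \<Longrightarrow> f \<in> L2 M \<Longrightarrow> g \<in> L2 M \<Longrightarrow>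
    L2_eq M (T (\<lambda>x. a * f x + b * g x)) (\<lambda>x. a * T f x + b * T g x)"
  by (simp add: L2_unitary_def)

lemma L2_unitary_scale:
  "L2_unitary M T \<Longrightarrow> f \<in> L2 M \<Longrightarrow> L2_eq M (T (\<lambda>x. a * f x)) (\<lambda>x. a * T f x)"
  using L2_unitary_linear[of M T f f a 0] by simp

lemma L2_unitary_add:
  "L2_unitary M T \<Longrightarrow> f \<in> L2 M \<Longrightarrow> g \<in> L2 M \<Longrightarrow> L2_eq M (T (\<lambda>x. f x + g x)) (\<lambda>x. T f x + T g x)"
  using L2_unitary_linear[of M T f g 1 1] by simp

lemma L2_unitary_diff:
  "L2_unitary M T \<Longrightarrow> f \<in> L2 M \<Longrightarrow> g \<in> L2 M \<Longrightarrow> L2_eq M (T (\<lambda>x. f x - g x)) (\<lambda>x. T f x - T g x)"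
  using L2_unitary_linear[of M T f g 1 "-1"] by simp

lemma L2_unitary_norm:
  assumes "L2_unitary M T" "f \<in> L2 M"
  shows "L2_norm M (T f) = L2_norm M f"
proof -
  have "L2_inner M (T f) (T f) = L2_inner M f f"
    using assms by (simp add: L2_unitary_def)
  then have "(L2_norm M (T f))\<^sup>2 = (L2_norm M f)\<^sup>2"
    unfolding L2_inner_self of_real_eq_iff .
  then show ?thesis by simp
qed

lemma L2_unitary_norm_diff:
  assumes "L2_unitary M T" "f \<in> L2 M" "g \<in> L2 M"
  shows "L2_norm M (\<lambda>x. T f x - T g x) = L2_norm M (\<lambda>x. f x - g x)"
proof -
  have "L2_norm M (\<lambda>x. T f x - T g x) = L2_norm M (T (\<lambda>x. f x - g x))"
    by (rule L2_norm_cong_AE)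
      (use assms L2_unitary_closed[OF assms(1)] in \<open>auto simp: L2_eq_sym[OF L2_unitary_diff]
          intro!: L2_measurable L2_diff\<close>)
  then show ?thesis using L2_unitary_norm[OF assms(1) L2_diff[OF assms(2,3)]] by simp
qed

subsection \<open>Smooth bump functions\<close>

text \<open>The product rule leaves one factor undifferentiated, whose order then has to be lowered
  by one.\<close>

lemma C_k_SucD: "C_k (Suc k) f \<Longrightarrow> C_k k f"
proof (induction k arbitrary: f)
  case 0
  then have "f differentiable (at p)" for p by simp
  then show ?case
    by (auto simp: continuous_on_eq_continuous_at intro: differentiable_imp_continuous_within)
next
  case (Suc k)
  then show ?case by (auto simp del: C_k.simps(1))
qed

lemma C_k_const: "C_k k (\<lambda>_. c)"
  by (induction k arbitrary: c) (auto simp: frechet_derivative_const)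

lemma C_k_add: "C_k k f \<Longrightarrow> C_k k g \<Longrightarrow> C_k k (\<lambda>p. f p + g p)"
proof (induction k arbitrary: f g)
  case 0
  then show ?case by (auto intro!: continuous_intros)
next
  case (Suc k)
  have "frechet_derivative (\<lambda>p. f p + g p) (at p) v = frechet_derivative f (at p) v + frechet_derivative g (at p) v" for p v
    using Suc.prems by (subst frechet_derivative_at[OF has_derivative_add, symmetric])
      (auto simp: frechet_derivative_works[symmetric])
  then show ?case using Suc by auto
qed

lemma C_k_mult:
  fixes f g :: "'a::real_normed_vector \<Rightarrow> 'b::real_normed_algebra"
  shows "C_k k f \<Longrightarrow> C_k k g \<Longrightarrow> C_k k (\<lambda>p. f p * g p)"
proof (induction k arbitrary: f g)
  case 0
  then show ?case by (auto intro!: continuous_intros)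
next
  case (Suc k)
  have "frechet_derivative (\<lambda>p. f p * g p) (at p) v =
      f p * frechet_derivative g (at p) v + frechet_derivative f (at p) v * g p" for p v
    using Suc.prems by (subst frechet_derivative_at[OF has_derivative_mult, symmetric])
      (auto simp: frechet_derivative_works[symmetric])
  then show ?case
    using Suc.prems C_k_SucD[OF Suc.prems(1)] C_k_SucD[OF Suc.prems(2)]
    by (auto intro!: C_k_add Suc.IH)
qed

text \<open>Admitting all polynomial factors makes the family closed under differentiation.\<close>

definition flat :: "real poly \<Rightarrow> real \<Rightarrow> real" where
  "flat q u = (if u > 0 then poly q (1 / u) * exp (- (1 / u)) else 0)"

lemma tendsto_poly_exp_at_top: "((\<lambda>t::real. poly q t * exp (- t)) \<longlongrightarrow> 0) at_top"
proof -
  have "((\<lambda>t::real. \<Sum>i\<le>degree q. coeff q i * (t ^ i / exp t)) \<longlongrightarrow> (\<Sum>i\<le>degree q. coeff q i * 0)) at_top"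
    by (intro tendsto_intros tendsto_power_div_exp_0)
  then show ?thesis
    by (simp add: poly_altdef exp_minus sum_distrib_left sum_distrib_right field_simps)
qed

lemma flat_tendsto_0: "(flat q \<longlongrightarrow> 0) (at 0)"
proof -
  have "((\<lambda>u::real. poly q (inverse u) * exp (- inverse u)) \<longlongrightarrow> 0) (at_right 0)"
    by (rule filterlim_compose[OF tendsto_poly_exp_at_top filterlim_inverse_at_top_right])
  then have "(flat q \<longlongrightarrow> 0) (at_right 0)"
    by (rule Lim_transform_eventually)
      (auto simp: flat_def field_simps eventually_at_filter)
  moreover have "(flat q \<longlongrightarrow> 0) (at_left 0)"
    by (rule tendsto_eventually) (auto simp: flat_def eventually_at_filter)
  ultimately show ?thesis
    using filterlim_split_at_real by blast
qed

text \<open>Chain rule in t = 1/u: since dt/du = -t^2, the derivative of q(t) exp(-t) in u is t^2 (q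
  - q')(t) exp(-t).\<close>

definition flat_deriv :: "real poly \<Rightarrow> real poly" where
  "flat_deriv q = [:0, 0, 1:] * (q - pderiv q)"

lemma flat_has_real_derivative: "(flat q has_real_derivative flat (flat_deriv q) u) (at u)"
proof (cases u "0::real" rule: linorder_cases)
  case less
  have "((\<lambda>_. 0) has_real_derivative 0) (at u)" by simp
  then have "(flat q has_real_derivative 0) (at u)"
    by (rule has_field_derivative_transform_within_open[where S = "{..<0}"])
      (use less in \<open>auto simp: flat_def\<close>)
  then show ?thesis using less by (simp add: flat_def)
next
  case equal
  \<comment> \<open>Dividing by h multiplies the polynomial in 1/h by its variable, so the
    difference quotient at 0 is again a flat function and tends to 0.\<close>
  have "flat (pCons 0 q) = (\<lambda>h. flat q h / h)"
    by (simp add: flat_def fun_eq_iff)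
  then have "((\<lambda>h. (flat q (0 + h) - flat q 0) / h) \<longlongrightarrow> 0) (at 0)"
    using flat_tendsto_0[of "pCons 0 q"] by (simp add: flat_def[of _ 0])
  then show ?thesis using equal by (simp add: DERIV_def flat_def[of _ 0])
next
  case greater
  have "((\<lambda>u. poly q (1 / u) * exp (- (1 / u))) has_real_derivative
      poly (flat_deriv q) (1 / u) * exp (- (1 / u))) (at u)"
    using greater
    by (auto intro!: derivative_eq_intros poly_DERIV[THEN DERIV_chain2]
        simp: flat_deriv_def field_simps power2_eq_square)
  then have "(flat q has_real_derivative poly (flat_deriv q) (1 / u) * exp (- (1 / u))) (at u)"
    by (rule has_field_derivative_transform_within_open[where S = "{0<..}"])
      (use greater in \<open>auto simp: flat_def\<close>)
  then show ?thesis using greater by (simp add: flat_def)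
qed

text \<open>The derivative \<open>l'\<close> is the same at all points, so a directional derivative
  is a constant times another flat function of \<open>l\<close>. The induction closes because
  \<open>q\<close> is arbitrary.\<close>

lemma C_k_flat_affine:
  fixes l :: "'a::real_normed_vector \<Rightarrow> real"
  assumes l: "\<And>p. (l has_derivative l') (at p)"
  shows "C_k k (\<lambda>p. complex_of_real (flat q (l p)))"
proof (induction k arbitrary: q)
  case 0
  have "continuous_on UNIV (flat q)"
    using flat_has_real_derivative DERIV_isCont continuous_at_imp_continuous_on by blast
  moreover have "continuous_on UNIV l"
    using l has_derivative_continuous continuous_at_imp_continuous_on by blast
  ultimately show ?case
    by (auto intro!: continuous_on_of_real continuous_on_compose2[of UNIV "flat q" UNIV l])
next
  case (Suc k)
  have D: "((\<lambda>p. complex_of_real (flat q (l p))) has_derivative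
      (\<lambda>v. complex_of_real (flat (flat_deriv q) (l p)) * complex_of_real (l' v))) (at p)" for p
    using has_derivative_of_real[OF has_derivative_compose[OF l
      flat_has_real_derivative[unfolded has_field_derivative_def]], where ?'a = complex, of q]
    by (simp)
  show ?case
    using D frechet_derivative_at[OF D, symmetric]
    by (auto simp: differentiable_def intro!: C_k_mult C_k_const Suc.IH)
qed

text \<open>The offset -1 keeps the support at distance 1/c from a and b, which makes it compact in
  the open interval; for large c the values tend to 1 inside, so bumps approximate indicators of
  intervals.\<close>

definition bump :: "real \<Rightarrow> real \<Rightarrow> real \<Rightarrow> real \<Rightarrow> complex" where
  "bump c a b x = of_real (flat 1 (c * (x - a) - 1) * flat 1 (c * (b - x) - 1))"

lemma bump_eq_0:
  assumes "c > 0" "x \<le> a + 1 / c \<or> b - 1 / c \<le> x"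
  shows "bump c a b x = 0"
  using assms by (auto simp: bump_def flat_def field_simps)

lemma bump_has_derivative:
  obtains b' where "\<And>x. (bump c a b has_vector_derivative b' x) (at x)" "continuous_on UNIV b'"
proof -
  define d where "d = (\<lambda>x. c * flat (flat_deriv 1) (c * (x - a) - 1) * flat 1 (c * (b - x) - 1)
     - c * flat 1 (c * (x - a) - 1) * flat (flat_deriv 1) (c * (b - x) - 1))"
  have "((\<lambda>x. flat 1 (c * (x - a) - 1) * flat 1 (c * (b - x) - 1)) has_real_derivative d x) (at x)" for x
    unfolding d_def
    by (auto intro!: derivative_eq_intros flat_has_real_derivative[THEN DERIV_chain2])
  then have 1: "(bump c a b has_vector_derivative complex_of_real (d x)) (at x)" for x
    unfolding bump_def[abs_def]
    by (rule has_vector_derivative_of_real)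
  have cont: "continuous_on UNIV (flat q)" for q
    using flat_has_real_derivative DERIV_isCont continuous_at_imp_continuous_on by blast
  have 2: "continuous_on UNIV (\<lambda>x. complex_of_real (d x))"
    unfolding d_def
    by (intro continuous_intros continuous_on_compose2[OF cont]) auto
  from 1 2 show thesis by (rule that)
qed

lemma continuous_on_bump: "continuous_on S (bump c a b)"
  using bump_has_derivative[of c a b] 
  by (metis continuous_at_imp_continuous_on has_vector_derivative_continuous)

lemma bump_tensor_in_test_functions:
  assumes "c > 0" "0 \<le> a" "b \<le> 1" "c' > 0" "0 \<le> a'" "b' \<le> 1"
  shows "tensor (bump c a b) (bump c' a' b') \<in> test_functions"
  unfolding test_functions_def
proof (intro CollectI conjI allI)
  fix k
  have "C_k k (\<lambda>p::real\<times>real. complex_of_real (flat 1 (c * (fst p - a) - 1)) * complex_of_real (flat 1 (c * (b - fst p) - 1))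
      * (complex_of_real (flat 1 (c' * (snd p - a') - 1)) * complex_of_real (flat 1 (c' * (b' - snd p) - 1))))"
    by (intro C_k_mult; rule C_k_flat_affine; auto intro!: derivative_eq_intros)
  then show "C_k k (tensor (bump c a b) (bump c' a' b'))"
    by (simp add: tensor_def bump_def case_prod_unfold)
next
  let ?K = "{a + 1 / c .. b - 1 / c} \<times> {a' + 1 / c' .. b' - 1 / c'}"
  have "compact ?K" by (intro compact_Times compact_Icc)
  moreover have "?K \<subseteq> {0<..<1} \<times> {0<..<1}"
  proof -
    have "{a + d..b - d} \<subseteq> {0<..<1}" if "d > 0" "0 \<le> a" "b \<le> 1" for a b d :: real
      using that by auto
    then show ?thesis using assms by (intro Sigma_mono) auto
  qed
  moreover have "tensor (bump c a b) (bump c' a' b') p = 0" if "p \<notin> ?K" for p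
    using that bump_eq_0[of c "fst p" a b] bump_eq_0[of c' "snd p" a' b'] assms
    by (auto simp: tensor_def case_prod_unfold mem_Times_iff)
  ultimately show "\<exists>K. compact K \<and> K \<subseteq> {0<..<1} \<times> {0<..<1} \<and>
      (\<forall>p. p \<notin> K \<longrightarrow> tensor (bump c a b) (bump c' a' b') p = 0)"
    by blast
qed

lemma flat_1_le: "0 \<le> flat 1 u" "flat 1 u \<le> 1"
  by (auto simp: flat_def)

lemma norm_bump_le: "cmod (bump c a b x) \<le> 1"
  using flat_1_le[of "c * (x - a) - 1"] flat_1_le[of "c * (b - x) - 1"]
  by (auto simp: bump_def norm_mult intro!: mult_le_one)

lemma bump_tendsto_indicator:
  "(\<lambda>n. bump (real (Suc n)) a b x) \<longlonglongrightarrow> indicator {a<..<b} x"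
proof -
  have 1: "(\<lambda>n. flat 1 (real (Suc n) * u - 1)) \<longlonglongrightarrow> (if u > 0 then 1 else 0)" for u :: real
  proof (cases "u > 0")
    case True
    have "filterlim (\<lambda>n. real (Suc n) * u) at_top sequentially"
      by (rule filterlim_at_top_mult_tendsto_pos[OF tendsto_const True])
        (rule filterlim_compose[OF filterlim_real_sequentially filterlim_Suc])
    then have lim: "filterlim (\<lambda>n. (-1) + real (Suc n) * u) at_top sequentially"
      by (rule filterlim_tendsto_add_at_top[OF tendsto_const])
    then have "(\<lambda>n. exp (- (1 / ((-1) + real (Suc n) * u)))) \<longlonglongrightarrow> exp (- 0)"
      by (intro tendsto_intros tendsto_divide_0[OF tendsto_const] filterlim_at_top_imp_at_infinity)
    moreover have "\<forall>\<^sub>F n in sequentially. (-1) + real (Suc n) * u > 0"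
      using lim by (simp only: filterlim_at_top_dense)
    then have "\<forall>\<^sub>F n in sequentially. exp (- (1 / ((-1) + real (Suc n) * u))) = flat 1 (real (Suc n) * u - 1)"
      by eventually_elim (simp add: flat_def)
    ultimately show ?thesis
      using True by (simp add: tendsto_cong)
  next
    case False
    then have "real (Suc n) * u - 1 \<le> 0" for n
      using mult_nonneg_nonpos[of "real (Suc n)" u] by simp
    then have "flat 1 (real (Suc n) * u - 1) = 0" for n
      by (simp add: flat_def not_less del: of_nat_Suc)
    then show ?thesis using False by (simp del: of_nat_Suc)
  qed
  have "(\<lambda>n. bump (real (Suc n)) a b x) \<longlonglongrightarrow>
      of_real ((if x - a > 0 then 1 else 0) * (if b - x > 0 then 1 else 0))"
    unfolding bump_def by (intro tendsto_intros 1)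
  then show ?thesis by (auto simp: indicator_def split: if_splits)
qed

subsection \<open>The interval and the square\<close>

lemma space_interval_M [simp]: "space interval_M = {0<..<1}"
  by (simp add: interval_M_def space_restrict_space)

interpretation interval: finite_measure interval_M
  by (rule finite_measureI)
    (simp add: interval_M_def emeasure_restrict_space space_restrict_space)

interpretation square: pair_sigma_finite interval_M interval_M ..

lemma space_square_M [simp]: "space square_M = {0<..<1} \<times> {0<..<1}"
  by (simp add: square_M_def space_pair_measure)

lemma finite_measure_square_M: "finite_measure square_M"
  unfolding square_M_def by (intro finite_measure_pair_measure interval.finite_measure_axioms)

lemma interval_M_measurable_borel: "f \<in> borel_measurable borel \<Longrightarrow> f \<in> borel_measurable interval_M"
  unfolding interval_M_def by (simp add: measurable_restrict_space1)

lemma square_M_measurable_borel: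
  assumes "f \<in> borel_measurable borel"
  shows "f \<in> borel_measurable square_M"
proof -
  have id: "(\<lambda>x. x) \<in> borel_measurable interval_M"
    by (rule interval_M_measurable_borel) simp
  have "(\<lambda>p. (fst p, snd p)) \<in> borel_measurable square_M"
    unfolding square_M_def
    by (intro borel_measurable_Pair measurable_compose[OF measurable_fst id]
        measurable_compose[OF measurable_snd id])
  then show ?thesis using measurable_compose[OF _ assms] by simp
qed

lemma continuous_measurable_interval:
  "continuous_on UNIV f \<Longrightarrow> f \<in> borel_measurable interval_M"
  by (intro interval_M_measurable_borel borel_measurable_continuous_onI)

lemma continuous_measurable_square:
  "continuous_on UNIV f \<Longrightarrow> f \<in> borel_measurable square_M"
  by (intro square_M_measurable_borel borel_measurable_continuous_onI)

lemma bounded_L2: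
  assumes "finite_measure M" "f \<in> borel_measurable M" "\<And>x. x \<in> space M \<Longrightarrow> cmod (f x) \<le> B"
  shows "f \<in> L2 M"
  by (rule L2_dominated[where g = "\<lambda>_. B\<^sup>2"])
    (use assms in \<open>auto intro: finite_measure.integrable_const power_mono\<close>)

lemma bump_L2 [intro]: "bump c a b \<in> L2 interval_M"
  by (rule bounded_L2[where B = 1, OF interval.finite_measure_axioms
      continuous_measurable_interval[OF continuous_on_bump] norm_bump_le])

section \<open>Dominated convergence in L^2 and density of the bumps in L^2(I)\<close>

lemma L2_tendsto_dominated:
  assumes F: "\<And>n. F n \<in> borel_measurable M" and f: "f \<in> borel_measurable M"
    and g: "integrable M (\<lambda>x. (g x)\<^sup>2)"
    and bd: "\<And>n x. x \<in> space M \<Longrightarrow> cmod (F n x) \<le> g x"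
    and lim: "\<And>x. x \<in> space M \<Longrightarrow> (\<lambda>n. F n x) \<longlonglongrightarrow> f x"
  shows "(\<lambda>n. L2_norm M (\<lambda>x. F n x - f x)) \<longlonglongrightarrow> 0"
proof -
  have bf: "cmod (f x) \<le> g x" if "x \<in> space M" for x
    using LIMSEQ_le_const2[OF tendsto_norm[OF lim[OF that]]] bd[OF that] by blast
  have "(\<lambda>n. LINT x|M. (cmod (F n x - f x))\<^sup>2) \<longlonglongrightarrow> (LINT x|M. 0)"
  \<comment> \<open>Both \<open>F n\<close> and its limit are bounded by \<open>g\<close>, so their
    difference is bounded by 2g; squaring gives the 4.\<close>
  proof (rule integral_dominated_convergence[where w = "\<lambda>x. 4 * (g x)\<^sup>2"])
    show "(\<lambda>x. (cmod (F n x - f x))\<^sup>2) \<in> borel_measurable M" for n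
      using F[of n] f by measurable
    show "integrable M (\<lambda>x. 4 * (g x)\<^sup>2)" using g by simp
    show "AE x in M. (\<lambda>n. (cmod (F n x - f x))\<^sup>2) \<longlonglongrightarrow> 0"
    proof (rule AE_I2)
      fix x assume x: "x \<in> space M"
      have "(\<lambda>n. (cmod (F n x - f x))\<^sup>2) \<longlonglongrightarrow> (cmod (f x - f x))\<^sup>2"
        by (intro tendsto_intros lim[OF x])
      then show "(\<lambda>n. (cmod (F n x - f x))\<^sup>2) \<longlonglongrightarrow> 0" by simp
    qed
    fix n
    show "AE x in M. norm ((cmod (F n x - f x))\<^sup>2) \<le> 4 * (g x)\<^sup>2"
    proof (rule AE_I2)
      fix x assume x: "x \<in> space M"
      have "cmod (F n x - f x) \<le> 2 * g x"
        using norm_triangle_ineq4[of "F n x" "f x"] bd[OF x, of n] bf[OF x] by linarith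
      then have "(cmod (F n x - f x))\<^sup>2 \<le> (2 * g x)\<^sup>2" by (intro power_mono) auto
      then show "norm ((cmod (F n x - f x))\<^sup>2) \<le> 4 * (g x)\<^sup>2" by (simp add: power_mult_distrib)
    qed
  qed simp
  then have "(\<lambda>n. sqrt (LINT x|M. (cmod (F n x - f x))\<^sup>2)) \<longlonglongrightarrow> sqrt 0"
    by (intro tendsto_real_sqrt) simp
  then show ?thesis by (simp add: L2_norm_def)
qed

lemma indicator_L2_interval:
  assumes "A \<in> sets borel"
  shows "indicator A \<in> L2 interval_M"
  by (rule bounded_L2[where B = 1, OF interval.finite_measure_axioms interval_M_measurable_borel])
    (use assms in \<open>auto simp: indicator_def\<close>)

text \<open>Density of the span of the bumps, phrased as an induction rule. The property passes from
  bumps to indicators of intervals, by the pi-lambda theorem to indicators of Borel sets, by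
  linearity to simple functions, and by limits to all of L^2.\<close>

lemma L2_interval_bump_induct [consumes 1, case_names bump lincomb lim]:
  assumes f: "f \<in> L2 interval_M"
    and bump: "\<And>c a b. c > 0 \<Longrightarrow> 0 \<le> a \<Longrightarrow> b \<le> 1 \<Longrightarrow> P (bump c a b)"
    and lincomb: "\<And>f g u v. f \<in> L2 interval_M \<Longrightarrow> g \<in> L2 interval_M \<Longrightarrow> P f \<Longrightarrow> P g \<Longrightarrow>
      P (\<lambda>x. u * f x + v * g x)"
    and lim: "\<And>F f. (\<And>n. F n \<in> L2 interval_M) \<Longrightarrow> (\<And>n. P (F n)) \<Longrightarrow> f \<in> L2 interval_M \<Longrightarrow>
      (\<lambda>n. L2_norm interval_M (\<lambda>x. F n x - f x)) \<longlonglongrightarrow> 0 \<Longrightarrow> P f"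
  shows "P f"
proof -
  have one: "integrable interval_M (\<lambda>_. (1::real)\<^sup>2)" by simp
  \<comment> \<open>A constant sequence converges to every function that agrees with it on the
    interval, so closure under limits already contains the change of values outside it.\<close>
  have cong: "P g" if "P f" "f \<in> L2 interval_M" "g \<in> L2 interval_M" "\<And>x. x \<in> {0<..<1} \<Longrightarrow> f x = g x"
    for f g
  proof (rule lim[of "\<lambda>_. f" g])
    have "L2_norm interval_M (\<lambda>x. f x - g x) = L2_norm interval_M (\<lambda>_. 0)"
      unfolding L2_norm_def by (intro arg_cong[of _ _ sqrt] Bochner_Integration.integral_cong) (use that in auto)
    then show "(\<lambda>n. L2_norm interval_M (\<lambda>x. f x - g x)) \<longlonglongrightarrow> 0" by (simp add: L2_norm_def)
  qed (use that in auto)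
  have box: "P (indicator (box a b))" for a b :: real
  proof -
    \<comment> \<open>Clipping puts the endpoints within the range allowed for bumps and alters the
      indicator only outside the open interval.\<close>
    let ?a = "max a 0" and ?b = "min b 1"
    have "P (indicator {?a<..<?b})"
    proof (rule lim[of "\<lambda>n. bump (real (Suc n)) ?a ?b"])
      show "(\<lambda>n. L2_norm interval_M (\<lambda>x. bump (real (Suc n)) ?a ?b x - indicator {?a<..<?b} x)) \<longlonglongrightarrow> 0"
        by (rule L2_tendsto_dominated[OF L2_measurable[OF bump_L2]
              L2_measurable[OF indicator_L2_interval] one])
          (use bump_tendsto_indicator norm_bump_le in \<open>auto simp del: of_nat_Suc\<close>)
    qed (auto intro!: bump indicator_L2_interval)
    then show ?thesis
      by (rule cong) (auto intro!: indicator_L2_interval simp: indicator_def)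
  qed
  have ind: "P (indicator A)" if "A \<in> sets borel" for A :: "real set"
  proof -
    let ?G = "range (\<lambda>(a, b). box a b) :: real set set"
    have sets: "sets borel = sigma_sets UNIV ?G"
      by (subst borel_eq_box) simp
    have "Int_stable ?G"
      by (auto simp: Int_stable_def box_real Int_greaterThanLessThan image_iff)
    moreover have "?G \<subseteq> Pow UNIV" by simp
    moreover have "A \<in> sigma_sets UNIV ?G" using that sets by simp
    ultimately show ?thesis
    proof (induction rule: sigma_sets_induct_disjoint)
      case (basic A)
      then show ?case using box by auto
    next
      case empty
      have "box 1 (0::real) = {}" by (simp add: box_real)
      then show ?case using box[of 1 0] by (simp only:)
    next
      case (compl A)
      have A: "A \<in> sets borel" using compl sets by simp
      \<comment> \<open>The indicator of \<open>box 0 1\<close> stands in for the constant 1, with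
        which it agrees on the interval.\<close>
      have "P (\<lambda>x. 1 * indicator (box 0 1) x + (- 1) * indicator A x)"
        by (intro lincomb indicator_L2_interval A box compl.IH) simp
      then show ?case
        by (rule cong[OF _ L2_add[OF L2_scale[OF indicator_L2_interval]
                L2_scale[OF indicator_L2_interval]] indicator_L2_interval])
          (use A in \<open>auto simp: box_real indicator_def\<close>)
    next
      case (union A)
      have A: "A n \<in> sets borel" for n using union sets by auto
      \<comment> \<open>Disjointness turns the indicator of a finite union into a sum; the countable
        union is then a dominated limit.\<close>
      have fin: "P (indicator (\<Union>i<n. A i))" for n
      proof (induction n)
        case 0
        have "box 1 (0::real) = (\<Union>i<0. A i)" by (simp add: box_real)
        then show ?case using box[of 1 0] by (simp only:)
      next
        case (Suc n)
        have "P (\<lambda>x. 1 * indicator (\<Union>i<n. A i) x + 1 * indicator (A n) x)"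
          by (intro lincomb indicator_L2_interval A Suc.IH union sets.finite_UN) auto
        moreover have "(\<lambda>x. 1 * indicator (\<Union>i<n. A i) x + 1 * indicator (A n) x) =
            (indicator (\<Union>i<Suc n. A i) :: real \<Rightarrow> complex)"
        proof
          fix x
          have "x \<notin> A n" if "x \<in> A i" "i < n" for i
            using that disjoint_family_onD[OF union.hyps(1), of i n] by auto
          then show "1 * indicator (\<Union>i<n. A i) x + 1 * indicator (A n) x =
            (indicator (\<Union>i<Suc n. A i) x :: complex)"
            by (auto simp: indicator_def less_Suc_eq)
        qed
        ultimately show ?case by simp
      qed
      show ?case
      proof (rule lim[of "\<lambda>n. indicator (\<Union>i<n. A i)"])
        show "(\<lambda>n. L2_norm interval_M (\<lambda>x. indicator (\<Union>i<n. A i) x - indicator (\<Union>i. A i) x)) \<longlonglongrightarrow> 0"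
        proof (rule L2_tendsto_dominated[OF _ _ one])
          show "(\<lambda>n. indicator (\<Union>i<n. A i) x :: complex) \<longlonglongrightarrow> indicator (\<Union>i. A i) x" for x
            by (rule LIMSEQ_indicator_UN)
        qed (use A in \<open>auto intro!: interval_M_measurable_borel simp: indicator_def\<close>)
      qed (use A fin in \<open>auto intro!: indicator_L2_interval\<close>)
    qed
  qed
  have simple: "P s" if s: "simple_function interval_M s" "s \<in> L2 interval_M" for s
  proof -
    \<comment> \<open>Level sets are cut down to the interval, since measurability of
      \<open>s\<close> says nothing about its values elsewhere.\<close>
    have meas: "s -` {y} \<inter> {0<..<1} \<in> sets borel" for y
    proof -
      have "s -` {y} \<inter> space interval_M \<in> sets interval_M"
        using s(1) by (rule simple_functionD)
      then show ?thesis by (auto simp: interval_M_def sets_restrict_space)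
    qed
    have fin: "finite (s ` {0<..<1})" using s(1) by (simp add: simple_function_def)
    have "P (\<lambda>x. \<Sum>y\<in>Y. y * indicator (s -` {y} \<inter> {0<..<1}) x) \<and>
        (\<lambda>x. \<Sum>y\<in>Y. y * indicator (s -` {y} \<inter> {0<..<1}) x) \<in> L2 interval_M" if "finite Y" for Y
      using that
    proof (induction Y)
      case empty
      have "P (\<lambda>x. 0 * indicator {} x + 0 * indicator {} x)"
        by (intro lincomb indicator_L2_interval ind) auto
      then show ?case using L2_scale[OF indicator_L2_interval, of "{}" 0] by simp
    next
      case (insert y Y)
      have "P (\<lambda>x. y * indicator (s -` {y} \<inter> {0<..<1}) x +
          1 * (\<Sum>y\<in>Y. y * indicator (s -` {y} \<inter> {0<..<1}) x))"
        by (intro lincomb indicator_L2_interval ind meas) (use insert in auto)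
      moreover have "(\<lambda>x. y * indicator (s -` {y} \<inter> {0<..<1}) x +
          1 * (\<Sum>y\<in>Y. y * indicator (s -` {y} \<inter> {0<..<1}) x)) \<in> L2 interval_M"
        by (intro L2_add L2_scale indicator_L2_interval meas) (use insert in blast)
      ultimately show ?case
        by (simp only: sum.insert[OF insert.hyps] mult_1_left)
    qed
    note sum = this[OF fin]
    show ?thesis
    proof (rule cong[OF sum[THEN conjunct1] sum[THEN conjunct2] s(2)])
      fix x :: real assume x: "x \<in> {0<..<1}"
      have "(\<Sum>y\<in>s ` {0<..<1}. y * indicator (s -` {y} \<inter> {0<..<1}) x) =
          (\<Sum>y\<in>s ` {0<..<1}. if y = s x then y else 0)"
        by (rule sum.cong) (use x in \<open>auto simp: indicator_def\<close>)
      then show "(\<Sum>y\<in>s ` {0<..<1}. y * indicator (s -` {y} \<inter> {0<..<1}) x) = s x"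
        using fin x by simp
    qed
  qed
  \<comment> \<open>Approximation about the base point 0 bounds the approximants by 2|f|, which
    supplies the dominating function.\<close>
  obtain F where F: "\<And>i. simple_function interval_M (F i)"
      "\<And>x. x \<in> {0<..<1} \<Longrightarrow> (\<lambda>i. F i x) \<longlonglongrightarrow> f x"
      "\<And>i x. x \<in> {0<..<1} \<Longrightarrow> cmod (F i x) \<le> 2 * cmod (f x)"
    using borel_measurable_implies_sequence_metric[OF L2_measurable[OF f], of 0]
    unfolding dist_norm diff_zero space_interval_M by blast
  have FL: "F i \<in> L2 interval_M" for i
  proof (rule L2_dominated[where g = "\<lambda>x. 4 * (cmod (f x))\<^sup>2"])
    show "(cmod (F i x))\<^sup>2 \<le> 4 * (cmod (f x))\<^sup>2" if "x \<in> space interval_M" for x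
      using power_mono[OF F(3)[of x i], of 2] that by (simp add: power_mult_distrib)
  qed (use F(1) f in \<open>auto intro: borel_measurable_simple_function L2_integrable_square\<close>)
  show "P f"
  proof (rule lim[of F])
    show "(\<lambda>n. L2_norm interval_M (\<lambda>x. F n x - f x)) \<longlonglongrightarrow> 0"
    proof (rule L2_tendsto_dominated[where g = "\<lambda>x. 2 * cmod (f x)"])
      show "integrable interval_M (\<lambda>x. (2 * cmod (f x))\<^sup>2)"
        using L2_integrable_square[OF f] by (simp add: power_mult_distrib)
    qed (use F FL f in \<open>auto intro: L2_measurable\<close>)
  qed (use f FL simple F(1) in auto)
qed

subsection \<open>Tensors and the exchange of the variables\<close>

lemma tensor_measurable [measurable]:
  assumes [measurable]: "f \<in> borel_measurable interval_M" "g \<in> borel_measurable interval_M"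
  shows "tensor f g \<in> borel_measurable square_M"
  unfolding tensor_def square_M_def by measurable

lemma tensor_L2:
  assumes f: "f \<in> L2 interval_M" and g: "g \<in> L2 interval_M"
  shows "tensor f g \<in> L2 square_M"
    and L2_norm_tensor: "L2_norm square_M (tensor f g) = L2_norm interval_M f * L2_norm interval_M g"
proof -
  have int: "integrable square_M (\<lambda>p. (cmod (tensor f g p))\<^sup>2)"
    unfolding square_M_def
  proof (rule square.Fubini_integrable)
    show "(\<lambda>p. (cmod (tensor f g p))\<^sup>2) \<in> borel_measurable (interval_M \<Otimes>\<^sub>M interval_M)"
      using tensor_measurable[OF L2_measurable[OF f] L2_measurable[OF g]] unfolding square_M_def by measurable
  qed (use L2_integrable_square[OF f] L2_integrable_square[OF g] in
      \<open>simp_all add: tensor_def norm_mult power_mult_distrib\<close>)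
  show "tensor f g \<in> L2 square_M"
    using int tensor_measurable[OF L2_measurable[OF f] L2_measurable[OF g]] by (simp add: L2_def)
  have "(LINT p|square_M. (cmod (tensor f g p))\<^sup>2) =
      (LINT x|interval_M. LINT y|interval_M. (cmod (tensor f g (x, y)))\<^sup>2)"
    using square.integral_fst'[of "\<lambda>p. (cmod (tensor f g p))\<^sup>2"] int by (simp add: square_M_def)
  also have "\<dots> = (LINT x|interval_M. (cmod (f x))\<^sup>2) * (LINT x|interval_M. (cmod (g x))\<^sup>2)"
    by (simp add: tensor_def norm_mult power_mult_distrib)
  finally show "L2_norm square_M (tensor f g) = L2_norm interval_M f * L2_norm interval_M g"
    by (simp add: L2_norm_def real_sqrt_mult)
qed

text \<open>\<open>\<sigma>\<close> is the identity for statements about \<open>\<partial>/\<partial>x\<close> and the exchange of the variables for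
  statements about \<open>\<partial>/\<partial>y\<close>.\<close>

definition is_flip :: "(real \<times> real \<Rightarrow> real \<times> real) \<Rightarrow> bool" where
  "is_flip \<sigma> \<longleftrightarrow> \<sigma> = (\<lambda>p. p) \<or> \<sigma> = prod.swap"

lemma is_flip_involution: "is_flip \<sigma> \<Longrightarrow> \<sigma> (\<sigma> p) = p"
  by (auto simp: is_flip_def)

lemma is_flip_bounded_linear: "is_flip \<sigma> \<Longrightarrow> bounded_linear \<sigma>"
  by (auto simp: is_flip_def prod.swap_def[abs_def] intro!: bounded_linear_intros)

lemma is_flip_square: "is_flip \<sigma> \<Longrightarrow> \<sigma> p \<in> {0<..<1} \<times> {0<..<1} \<longleftrightarrow> p \<in> {0<..<1} \<times> {0<..<1}"
  by (cases p) (auto simp: is_flip_def)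

lemma is_flip_measurable: "is_flip \<sigma> \<Longrightarrow> \<sigma> \<in> measurable square_M square_M"
  unfolding square_M_def is_flip_def
  using measurable_pair_swap'[of interval_M interval_M] by (auto simp: prod.swap_def[abs_def] case_prod_unfold)

lemma is_flip_distr: "is_flip \<sigma> \<Longrightarrow> distr square_M square_M \<sigma> = square_M"
  using square.distr_pair_swap
  by (auto simp: is_flip_def square_M_def prod.swap_def[abs_def] case_prod_unfold distr_id2)

lemma flip_L2_eq:
  assumes \<sigma>: "is_flip \<sigma>" and f: "f \<in> borel_measurable square_M" and g: "g \<in> borel_measurable square_M"
  shows "L2_eq square_M (\<lambda>p. f (\<sigma> p)) (\<lambda>p. g (\<sigma> p)) \<longleftrightarrow> L2_eq square_M f g"
proof -
  have "{p \<in> space square_M. f p = g p} \<in> sets square_M" using f g by measurable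
  then show ?thesis
    unfolding L2_eq_def
    using AE_distr_iff[OF is_flip_measurable[OF \<sigma>], of "\<lambda>p. f p = g p"]
    unfolding is_flip_distr[OF \<sigma>] by simp
qed

lemma flip_integral:
  fixes f :: "real \<times> real \<Rightarrow> 'b::{banach, second_countable_topology}"
  assumes \<sigma>: "is_flip \<sigma>" and f: "f \<in> borel_measurable square_M"
  shows "(LINT p|square_M. f (\<sigma> p)) = (LINT p|square_M. f p)"
  using integral_distr[OF is_flip_measurable[OF \<sigma>] f] by (simp add: is_flip_distr[OF \<sigma>])

lemma flip_L2:
  assumes \<sigma>: "is_flip \<sigma>" and f: "f \<in> L2 square_M"
  shows "(\<lambda>p. f (\<sigma> p)) \<in> L2 square_M"
    and flip_L2_norm: "L2_norm square_M (\<lambda>p. f (\<sigma> p)) = L2_norm square_M f"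
proof -
  have m: "(\<lambda>p. (cmod (f p))\<^sup>2) \<in> borel_measurable square_M" using f by measurable
  have "integrable square_M (\<lambda>p. (cmod (f (\<sigma> p)))\<^sup>2)"
    using integrable_distr_eq[OF is_flip_measurable[OF \<sigma>] m] L2_integrable_square[OF f]
    by (simp add: is_flip_distr[OF \<sigma>])
  then show "(\<lambda>p. f (\<sigma> p)) \<in> L2 square_M"
    using measurable_compose[OF is_flip_measurable[OF \<sigma>] L2_measurable[OF f]] by (simp add: L2_def)
  show "L2_norm square_M (\<lambda>p. f (\<sigma> p)) = L2_norm square_M f"
    unfolding L2_norm_def using flip_integral[OF \<sigma> m] by simp
qed

definition ftensor :: "(real \<times> real \<Rightarrow> real \<times> real) \<Rightarrow> (real \<Rightarrow> complex) \<Rightarrow> (real \<Rightarrow> complex) \<Rightarrow> real \<times> real \<Rightarrow> complex"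
  where "ftensor \<sigma> f g p = tensor f g (\<sigma> p)"

lemma ftensor_alt: "ftensor \<sigma> f g p = f (fst (\<sigma> p)) * g (snd (\<sigma> p))"
  by (simp add: ftensor_def tensor_def case_prod_unfold)

lemma ftensor_swap: "is_flip \<sigma> \<Longrightarrow> ftensor (prod.swap \<circ> \<sigma>) f g = ftensor \<sigma> g f"
  by (auto simp: ftensor_def tensor_def case_prod_unfold fun_eq_iff)

lemma ftensor_L2 [intro]:
  "is_flip \<sigma> \<Longrightarrow> f \<in> L2 interval_M \<Longrightarrow> g \<in> L2 interval_M \<Longrightarrow> ftensor \<sigma> f g \<in> L2 square_M"
  using flip_L2[of \<sigma>] tensor_L2 by (simp add: ftensor_def[abs_def])

lemma L2_norm_ftensor:
  "is_flip \<sigma> \<Longrightarrow> f \<in> L2 interval_M \<Longrightarrow> g \<in> L2 interval_M \<Longrightarrow>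
    L2_norm square_M (ftensor \<sigma> f g) = L2_norm interval_M f * L2_norm interval_M g"
  using flip_L2_norm[of \<sigma>] tensor_L2 L2_norm_tensor by (simp add: ftensor_def[abs_def])

text \<open>Prepares the integration of a relation on the square over the first variable with the
  second one fixed.\<close>

lemma AE_pair_commute:
  assumes "AE p in square_M. P p" "Measurable.pred square_M P"
  shows "AE y in interval_M. AE x in interval_M. P (x, y)"
proof -
  have "AE x in interval_M. AE y in interval_M. P (x, y)"
    by (rule square.AE_pair[OF assms(1)[unfolded square_M_def]])
  moreover have "{x \<in> space (interval_M \<Otimes>\<^sub>M interval_M). P (fst x, snd x)} \<in> sets (interval_M \<Otimes>\<^sub>M interval_M)"
    using assms(2) by (simp add: pred_def square_M_def)
  ultimately show ?thesis
    using square.AE_commute[of "\<lambda>x y. P (x, y)"] by blast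
qed

text \<open>The factors are replaced one at a time; each difference is a tensor with a null factor,
  and norms of tensors multiply.\<close>

lemma L2_eq_ftensor:
  assumes \<sigma>: "is_flip \<sigma>" and f: "f \<in> L2 interval_M" "f' \<in> L2 interval_M"
    and g: "g \<in> L2 interval_M" "g' \<in> L2 interval_M"
    and eq: "L2_eq interval_M f f'" "L2_eq interval_M g g'"
  shows "L2_eq square_M (ftensor \<sigma> f g) (ftensor \<sigma> f' g')"
proof -
  have 0: "L2_norm interval_M (\<lambda>x. u x - v x) = 0"
    if "u \<in> L2 interval_M" "v \<in> L2 interval_M" "L2_eq interval_M u v" for u v
  proof -
    have "L2_norm interval_M (\<lambda>x. u x - v x) = L2_norm interval_M (\<lambda>_. 0)"
      by (rule L2_norm_cong_AE)
        (use that in \<open>auto simp: L2_eq_def intro: L2_measurable L2_diff\<close>)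
    then show ?thesis by (simp add: L2_norm_def)
  qed
  have "L2_norm square_M (ftensor \<sigma> (\<lambda>x. f x - f' x) g) = 0"
    using 0[OF f eq(1)] by (simp add: L2_norm_ftensor \<sigma> f g L2_diff)
  then have 1: "L2_norm square_M (\<lambda>p. ftensor \<sigma> f g p - ftensor \<sigma> f' g p) = 0"
    by (simp add: ftensor_alt[abs_def] algebra_simps)
  have "L2_norm square_M (ftensor \<sigma> f' (\<lambda>x. g x - g' x)) = 0"
    using 0[OF g eq(2)] by (simp add: L2_norm_ftensor \<sigma> f g L2_diff)
  then have 2: "L2_norm square_M (\<lambda>p. ftensor \<sigma> f' g p - ftensor \<sigma> f' g' p) = 0"
    by (simp add: ftensor_alt[abs_def] algebra_simps)
  show ?thesis
    using L2_eq_if_norm_diff_0[OF _ _ 1] L2_eq_if_norm_diff_0[OF _ _ 2]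
    by (blast intro: L2_eq_trans ftensor_L2 \<sigma> f g)
qed

section \<open>Test functions separate the elements of L^2 of the square\<close>

lemma bump_ftensor_in_test_functions:
  assumes "is_flip \<sigma>" "c > 0" "0 \<le> a" "b \<le> 1" "c' > 0" "0 \<le> a'" "b' \<le> 1"
  shows "ftensor \<sigma> (bump c a b) (bump c' a' b') \<in> test_functions"
proof -
  have "ftensor prod.swap (bump c a b) (bump c' a' b') = tensor (bump c' a' b') (bump c a b)"
    by (auto simp: ftensor_def tensor_def fun_eq_iff)
  then show ?thesis
    using bump_tensor_in_test_functions assms by (auto simp: is_flip_def ftensor_def[abs_def])
qed

text \<open>Rectangles are stable under intersection and generate the product sigma-algebra, while
  the sets over which \<open>w\<close> integrates to 0 form a Dynkin system. Hence all integrals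
  vanish, and real and imaginary part vanish as densities.\<close>

lemma integral_rectangles_0_imp_AE_0:
  fixes w :: "real \<times> real \<Rightarrow> complex"
  assumes w: "integrable square_M w"
    and rect: "\<And>A B. A \<in> sets interval_M \<Longrightarrow> B \<in> sets interval_M \<Longrightarrow>
      (LINT p|square_M. indicator (A \<times> B) p *\<^sub>R w p) = 0"
  shows "AE p in square_M. w p = 0"
proof -
  let ?G = "{A \<times> B | A B. A \<in> sets interval_M \<and> B \<in> sets interval_M}"
  have sets: "sets square_M = sigma_sets (space square_M) ?G"
    by (simp add: square_M_def sets_pair_measure space_pair_measure)
  have int: "integrable square_M (\<lambda>p. indicator A p *\<^sub>R w p)" if "A \<in> sets square_M" for A
    using integrable_mult_indicator[OF that w] .
  have zero: "(LINT p|square_M. indicator A p *\<^sub>R w p) = 0" if "A \<in> sets square_M" for A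
  proof -
    note Int_stable_pair_measure_generator[of interval_M interval_M]
    moreover have "?G \<subseteq> Pow (space square_M)"
      using sets.sets_into_space by (fastforce simp: square_M_def space_pair_measure)
    moreover have "A \<in> sigma_sets (space square_M) ?G" using that sets by simp
    ultimately show ?thesis
    proof (induction rule: sigma_sets_induct_disjoint)
      case (basic A)
      then show ?case using rect by auto
    next
      case empty
      show ?case by simp
    next
      case (compl A)
      have A: "A \<in> sets square_M" using compl sets by simp
      have "(LINT p|square_M. indicator (space square_M - A) p *\<^sub>R w p) =
          (LINT p|square_M. w p - indicator A p *\<^sub>R w p)"
        by (rule Bochner_Integration.integral_cong) (auto simp: indicator_def)
      also have "\<dots> = (LINT p|square_M. w p)"
        using w int[OF A] compl.IH by simp
      \<comment> \<open>The whole square is itself a rectangle, which settles complements.\<close>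
      also have "\<dots> = (LINT p|square_M. indicator ({0<..<1} \<times> {0<..<1}) p *\<^sub>R w p)"
        by (rule Bochner_Integration.integral_cong) auto
      also have "\<dots> = 0"
        using sets.top[of interval_M] by (intro rect) simp_all
      finally show ?case .
    next
      case (union A)
      have A: "A n \<in> sets square_M" for n using union sets by auto
      have "(\<lambda>n. LINT p|square_M. indicator (\<Union>i<n. A i) p *\<^sub>R w p) \<longlonglongrightarrow>
          (LINT p|square_M. indicator (\<Union>i. A i) p *\<^sub>R w p)"
      proof (rule integral_dominated_convergence[where w = "\<lambda>p. cmod (w p)"])
        show "AE p in square_M. (\<lambda>n. indicator (\<Union>i<n. A i) p *\<^sub>R w p) \<longlonglongrightarrow> indicator (\<Union>i. A i) p *\<^sub>R w p"
          by (intro AE_I2 tendsto_intros LIMSEQ_indicator_UN)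
        show "AE p in square_M. norm (indicator (\<Union>i<n. A i) p *\<^sub>R w p) \<le> cmod (w p)" for n
          by (auto simp: indicator_def)
      qed (use A w in \<open>auto intro!: borel_measurable_integrable int\<close>)
      moreover have "(LINT p|square_M. indicator (\<Union>i<n. A i) p *\<^sub>R w p) = 0" for n
      proof (induction n)
        case 0
        show ?case by simp
      next
        case (Suc n)
        have "(LINT p|square_M. indicator (\<Union>i<Suc n. A i) p *\<^sub>R w p) =
            (LINT p|square_M. indicator (\<Union>i<n. A i) p *\<^sub>R w p + indicator (A n) p *\<^sub>R w p)"
        proof (rule Bochner_Integration.integral_cong)
          fix p
          have "p \<notin> A n" if "p \<in> A i" "i < n" for i
            using that disjoint_family_onD[OF union.hyps(1), of i n] by auto
          then show "indicator (\<Union>i<Suc n. A i) p *\<^sub>R w p =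
              indicator (\<Union>i<n. A i) p *\<^sub>R w p + indicator (A n) p *\<^sub>R w p"
            by (auto simp: indicator_def less_Suc_eq)
        qed simp
        also have "\<dots> = 0"
          using int[of "\<Union>i<n. A i"] int[OF A[of n]] A Suc.IH union.IH[of n] by simp
        finally show ?case .
      qed
      ultimately show ?case by (simp only: LIMSEQ_const_iff)
    qed
  qed
  have "AE p in square_M. Re (w p) = 0"
  proof (rule density_unique_real)
    show "(LINT p:A|square_M. Re (w p)) = (LINT p:A|square_M. 0)" if "A \<in> sets square_M" for A
      using arg_cong[OF zero[OF that], of Re] integral_Re[OF int[OF that]]
      by (simp add: set_lebesgue_integral_def)
  qed (use w in auto)
  moreover have "AE p in square_M. Im (w p) = 0"
  proof (rule density_unique_real)
    show "(LINT p:A|square_M. Im (w p)) = (LINT p:A|square_M. 0)" if "A \<in> sets square_M" for A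
      using arg_cong[OF zero[OF that], of Im] integral_Im[OF int[OF that]]
      by (simp add: set_lebesgue_integral_def)
  qed (use w in auto)
  ultimately show ?thesis by eventually_elim (simp add: complex_eq_iff)
qed

text \<open>The fundamental lemma of the calculus of variations. Products of bumps are test
  functions; density in each variable separately extends the vanishing to all tensors, in particular
  to indicators of rectangles.\<close>

lemma test_functions_separate:
  assumes w: "w \<in> L2 square_M"
    and test: "\<And>\<psi>. \<psi> \<in> test_functions \<Longrightarrow> \<psi> \<in> L2 square_M \<Longrightarrow> (LINT p|square_M. \<psi> p * w p) = 0"
  shows "AE p in square_M. w p = 0"
proof -
  \<comment> \<open>Only the first factor is approximated here; using this once with the identity
    and once with the swap treats both factors.\<close>
  have step: "(LINT p|square_M. ftensor \<sigma> f g p * w p) = 0"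
    if \<sigma>: "is_flip \<sigma>" and f: "f \<in> L2 interval_M" and g: "g \<in> L2 interval_M"
      and b: "\<And>c a b. c > 0 \<Longrightarrow> 0 \<le> a \<Longrightarrow> b \<le> 1 \<Longrightarrow> (LINT p|square_M. ftensor \<sigma> (bump c a b) g p * w p) = 0"
    for \<sigma> f g
    using f
  proof (induction rule: L2_interval_bump_induct)
    case (bump c a b)
    then show ?case by (rule b)
  next
    case (lincomb f f' u v)
    have "(\<lambda>p. ftensor \<sigma> (\<lambda>x. u * f x + v * f' x) g p * w p) =
        (\<lambda>p. u * (ftensor \<sigma> f g p * w p) + v * (ftensor \<sigma> f' g p * w p))"
      by (simp add: ftensor_alt fun_eq_iff algebra_simps)
    then show ?case
      using lincomb L2_integrable_mult[OF ftensor_L2[OF \<sigma> lincomb.hyps(1) g] w]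
        L2_integrable_mult[OF ftensor_L2[OF \<sigma> lincomb.hyps(2) g] w] by simp
  next
    case (lim F f)
    have "cmod (LINT p|square_M. ftensor \<sigma> f g p * w p) \<le>
        L2_norm interval_M (\<lambda>x. F n x - f x) * (L2_norm interval_M g * L2_norm square_M w)" for n
    proof -
      have "(LINT p|square_M. ftensor \<sigma> (\<lambda>x. f x - F n x) g p * w p) =
          (LINT p|square_M. ftensor \<sigma> f g p * w p - ftensor \<sigma> (F n) g p * w p)"
        by (simp add: ftensor_alt algebra_simps)
      also have "\<dots> = (LINT p|square_M. ftensor \<sigma> f g p * w p)"
        using lim.IH[of n] L2_integrable_mult[OF ftensor_L2[OF \<sigma> lim.hyps(1) g] w]
          L2_integrable_mult[OF ftensor_L2[OF \<sigma> lim.hyps(2) g] w] by simp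
      also have "(LINT p|square_M. ftensor \<sigma> (\<lambda>x. f x - F n x) g p * w p) =
          L2_inner square_M (ftensor \<sigma> (\<lambda>x. f x - F n x) g) (\<lambda>p. cnj (w p))"
        by (simp add: L2_inner_def)
      finally have "cmod (LINT p|square_M. ftensor \<sigma> f g p * w p) =
          cmod (L2_inner square_M (ftensor \<sigma> (\<lambda>x. f x - F n x) g) (\<lambda>p. cnj (w p)))" by simp
      also have "\<dots> \<le> L2_norm square_M (ftensor \<sigma> (\<lambda>x. f x - F n x) g) * L2_norm square_M (\<lambda>p. cnj (w p))"
        by (intro L2_Cauchy_Schwarz ftensor_L2 L2_diff L2_cnj \<sigma> lim g w)
      also have "\<dots> = L2_norm interval_M (\<lambda>x. F n x - f x) * (L2_norm interval_M g * L2_norm square_M w)"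
        using L2_norm_minus_commute[of interval_M f "F n"]
        by (subst L2_norm_ftensor) (use \<sigma> lim g in \<open>auto simp: L2_norm_def\<close>)
      finally show ?thesis .
    qed
    moreover have "(\<lambda>n. L2_norm interval_M (\<lambda>x. F n x - f x) * (L2_norm interval_M g * L2_norm square_M w)) \<longlonglongrightarrow> 0"
      using tendsto_mult_left_zero[OF lim.hyps(3)] .
    ultimately have "cmod (LINT p|square_M. ftensor \<sigma> f g p * w p) \<le> 0"
      by (intro LIMSEQ_le_const) auto
    then show ?case by simp
  qed
  have id: "is_flip (\<lambda>p. p)" and swap: "is_flip prod.swap" by (auto simp: is_flip_def)
  have tens: "(LINT p|square_M. tensor f g p * w p) = 0" if f: "f \<in> L2 interval_M" and g: "g \<in> L2 interval_M" for f g
  proof -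
    have "(LINT p|square_M. ftensor (\<lambda>p. p) f g p * w p) = 0"
    proof (rule step[OF id f g])
      fix c a b :: real assume cab: "c > 0" "0 \<le> a" "b \<le> 1"
      have "(LINT p|square_M. ftensor prod.swap g (bump c a b) p * w p) = 0"
      proof (rule step[OF swap g])
        fix c' a' b' :: real assume cab': "c' > 0" "0 \<le> a'" "b' \<le> 1"
        show "(LINT p|square_M. ftensor prod.swap (bump c' a' b') (bump c a b) p * w p) = 0"
          using bump_ftensor_in_test_functions[OF swap] cab cab' by (intro test ftensor_L2 swap) auto
      qed auto
      then show "(LINT p|square_M. ftensor (\<lambda>p. p) (bump c a b) g p * w p) = 0"
        by (simp add: ftensor_alt mult.commute)
    qed
    then show ?thesis by (simp add: ftensor_def)
  qed
  show ?thesis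
  proof (rule integral_rectangles_0_imp_AE_0)
    have "(\<lambda>_. 1) \<in> L2 square_M"
      by (rule bounded_L2[OF finite_measure_square_M, where B = 1]) auto
    from L2_integrable_mult[OF this w] show "integrable square_M w" by simp
    fix A B assume AB: "A \<in> sets interval_M" "B \<in> sets interval_M"
    then have "A \<in> sets borel" "B \<in> sets borel"
      by (auto simp: interval_M_def sets_restrict_space)
    then have "(LINT p|square_M. tensor (indicator A) (indicator B) p * w p) = 0"
      by (intro tens indicator_L2_interval)
    then show "(LINT p|square_M. indicator (A \<times> B) p *\<^sub>R w p) = 0"
      by (simp add: tensor_def case_prod_unfold indicator_times scaleR_conv_of_real of_real_indicator)
  qed
qed

subsection \<open>The maximal operator on tensors\<close>

lemma continuous_L2_interval:
  assumes "continuous_on UNIV f"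
  shows "f \<in> L2 interval_M"
proof -
  have "bounded (f ` {0..1})"
    by (intro compact_imp_bounded compact_continuous_image)
      (auto intro: continuous_on_subset[OF assms])
  then obtain B where B: "\<And>x. x \<in> {0..1} \<Longrightarrow> cmod (f x) \<le> B"
    unfolding bounded_iff by blast
  show ?thesis
    by (rule bounded_L2[OF interval.finite_measure_axioms continuous_measurable_interval[OF assms], of B])
      (auto intro: B)
qed

lemma continuous_L2_square:
  assumes "continuous_on UNIV f"
  shows "f \<in> L2 square_M"
proof -
  have "bounded (f ` ({0..1} \<times> {0..1}))"
    by (intro compact_imp_bounded compact_continuous_image compact_Times)
      (auto intro: continuous_on_subset[OF assms])
  then obtain B where B: "\<And>x. x \<in> {0..1} \<times> {0..1} \<Longrightarrow> cmod (f x) \<le> B"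
    unfolding bounded_iff by blast
  show ?thesis
    by (rule bounded_L2[OF finite_measure_square_M continuous_measurable_square[OF assms], of B])
      (auto intro: B)
qed

lemma integral_interval_M_FTC:
  fixes F :: "real \<Rightarrow> complex"
  assumes F: "\<And>x. (F has_vector_derivative F' x) (at x)" and cont: "continuous_on UNIV F'"
  shows "(LINT x|interval_M. F' x) = F 1 - F 0"
proof -
  have "(LINT x|interval_M. F' x) = (LINT x|lborel. indicator {0<..<1} x *\<^sub>R F' x)"
    unfolding interval_M_def by (rule integral_restrict_space) simp
  also have "\<dots> = (LINT x|lborel. indicator {0..1} x *\<^sub>R F' x)"
  proof (rule integral_cong_AE)
    have [measurable]: "F' \<in> borel_measurable lborel"
      using borel_measurable_continuous_onI[OF cont] by simp
    show "(\<lambda>x. indicator {0<..<1} x *\<^sub>R F' x) \<in> borel_measurable lborel"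
      "(\<lambda>x. indicator {0..1} x *\<^sub>R F' x) \<in> borel_measurable lborel"
      by measurable
    show "AE x in lborel. indicator {0<..<1} x *\<^sub>R F' x = indicator {0..1} x *\<^sub>R F' x"
      using AE_lborel_singleton[of 0] AE_lborel_singleton[of 1]
      by eventually_elim (auto simp: indicator_def)
  qed
  also have "\<dots> = F 1 - F 0"
    by (rule integral_FTC_atLeastAtMost)
      (auto intro: has_vector_derivative_at_within F continuous_on_subset[OF cont])
  finally show ?thesis .
qed

lemma L2_inner_cong_AE:
  assumes "f \<in> L2 M" "f' \<in> L2 M" "g \<in> L2 M" "L2_eq M f f'"
  shows "L2_inner M f g = L2_inner M f' g"
  unfolding L2_inner_def
proof (rule integral_cong_AE)
  show "AE x in M. f x * cnj (g x) = f' x * cnj (g x)"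
    using assms(4) by (auto simp: L2_eq_def elim!: AE_mp)
qed (use assms in \<open>auto intro!: borel_measurable_integrable L2_inner_integrable\<close>)

lemma test_function_C_k: "\<psi> \<in> test_functions \<Longrightarrow> C_k k \<psi>"
  by (simp add: test_functions_def)

lemma test_function_continuous: "\<psi> \<in> test_functions \<Longrightarrow> continuous_on UNIV \<psi>"
  using test_function_C_k[of \<psi> 0] by simp

lemma test_function_differentiable: "\<psi> \<in> test_functions \<Longrightarrow> \<psi> differentiable (at p)"
  using test_function_C_k[of \<psi> "Suc 0"] unfolding C_k.simps by blast

lemma test_function_derivative_continuous:
  "\<psi> \<in> test_functions \<Longrightarrow> continuous_on UNIV (\<lambda>p. frechet_derivative \<psi> (at p) v)"
  using test_function_C_k[of \<psi> "Suc 0"] unfolding C_k.simps by blast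

lemma test_function_eq_0:
  assumes "\<psi> \<in> test_functions" "p \<notin> {0<..<1} \<times> {0<..<1}"
  shows "\<psi> p = 0"
  using assms unfolding test_functions_def by blast

lemma test_function_in_min_momentum:
  assumes "\<psi> \<in> test_functions"
  shows "(\<psi>, \<lambda>p. (1 / \<i>) * frechet_derivative \<psi> (at p) v) \<in> min_momentum v"
proof -
  have "\<psi> \<in> L2 square_M" "(\<lambda>p. (1 / \<i>) * frechet_derivative \<psi> (at p) v) \<in> L2 square_M"
    by (intro L2_scale continuous_L2_square test_function_continuous
        test_function_derivative_continuous assms)+
  then show ?thesis
    unfolding min_momentum_def using assms L2_eq_refl by blast
qed

lemma max_momentum_L2:
  assumes "(f, k) \<in> max_momentum v"
  shows "f \<in> L2 square_M" "k \<in> L2 square_M"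
  using assms by (simp_all add: max_momentum_def L2_adjoint_def)

lemma max_momentum_inner:
  assumes "(f, k) \<in> max_momentum v" "(a, b) \<in> min_momentum v"
  shows "L2_inner square_M b f = L2_inner square_M a k"
  using assms unfolding max_momentum_def L2_adjoint_def by blast

lemma max_momentumI:
  assumes "f \<in> L2 square_M" "k \<in> L2 square_M"
    and "\<And>a b. (a, b) \<in> min_momentum v \<Longrightarrow> L2_inner square_M b f = L2_inner square_M a k"
  shows "(f, k) \<in> max_momentum v"
  using assms unfolding max_momentum_def L2_adjoint_def by blast

text \<open>Integration by parts along the lines in direction \<open>\<sigma> (1, 0)\<close>. A test
  function vanishes at both ends of each line, so the values of \<open>p\<close> at the boundary
  leave no trace; \<open>g\<close> is constant along the lines.\<close>

lemma max_momentum_ftensor: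
  assumes \<sigma>: "is_flip \<sigma>"
    and p: "\<And>x. (p has_vector_derivative p' x) (at x)" and p': "continuous_on UNIV p'"
    and g: "g \<in> L2 interval_M"
  shows "(ftensor \<sigma> p g, \<lambda>z. (1 / \<i>) * ftensor \<sigma> p' g z) \<in> max_momentum (\<sigma> (1, 0))"
proof -
  have pc: "continuous_on UNIV p"
    using p by (meson continuous_at_imp_continuous_on has_vector_derivative_continuous)
  have pL: "p \<in> L2 interval_M" "p' \<in> L2 interval_M" using pc p' by (auto intro: continuous_L2_interval)
  have u: "ftensor \<sigma> p g \<in> L2 square_M" and u': "ftensor \<sigma> p' g \<in> L2 square_M"
    using \<sigma> pL g by auto
  have inner: "L2_inner square_M k (ftensor \<sigma> p g) = L2_inner square_M f (\<lambda>z. (1 / \<i>) * ftensor \<sigma> p' g z)"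
    if fk: "(f, k) \<in> min_momentum (\<sigma> (1, 0))" for f k
  proof -
    obtain \<psi> where \<psi>: "\<psi> \<in> test_functions" "L2_eq square_M f \<psi>"
        "L2_eq square_M k (\<lambda>p. (1 / \<i>) * frechet_derivative \<psi> (at p) (\<sigma> (1, 0)))"
      and L: "f \<in> L2 square_M" "k \<in> L2 square_M"
      using fk by (auto simp: min_momentum_def)
    define D where "D = (\<lambda>p. frechet_derivative \<psi> (at p) (\<sigma> (1, 0)))"
    have \<psi>c: "continuous_on UNIV \<psi>" and Dc: "continuous_on UNIV D"
      using \<psi>(1) by (auto simp: D_def test_function_continuous test_function_derivative_continuous)
    have \<psi>L: "\<psi> \<in> L2 square_M" and DL: "D \<in> L2 square_M"
      using \<psi>c Dc by (auto intro: continuous_L2_square)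
    \<comment> \<open>Along each such line \<open>h\<close> is the derivative of
      \<open>\<psi>\<close> times the conjugated tensor.\<close>
    define h where "h = (\<lambda>z. D z * cnj (ftensor \<sigma> p g z) + \<psi> z * cnj (ftensor \<sigma> p' g z))"
    have h: "integrable square_M h"
      unfolding h_def by (intro Bochner_Integration.integrable_add L2_inner_integrable DL \<psi>L u u')
    have h_flip: "h (\<sigma> (x, y)) = (D (\<sigma> (x, y)) * cnj (p x) + \<psi> (\<sigma> (x, y)) * cnj (p' x)) * cnj (g y)" for x y
      by (simp add: h_def ftensor_alt is_flip_involution[OF \<sigma>] algebra_simps)
    have sc: "continuous_on UNIV (\<lambda>x. \<sigma> (x, y))" for y
      by (intro bounded_linear.continuous_on[OF is_flip_bounded_linear[OF \<sigma>]] continuous_intros)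
    have inner0: "(LINT x|interval_M. h (\<sigma> (x, y))) = 0" if "y \<in> {0<..<1}" for y
    proof -
      have D: "((\<lambda>x. \<psi> (\<sigma> (x, y))) has_vector_derivative D (\<sigma> (x, y))) (at x)" for x
      proof -
        have "((\<lambda>x. \<sigma> (x, y)) has_derivative (\<lambda>v. \<sigma> (v, 0))) (at x)"
          by (intro bounded_linear.has_derivative[OF is_flip_bounded_linear[OF \<sigma>]])
            (auto intro!: derivative_eq_intros)
        moreover have "(\<psi> has_derivative frechet_derivative \<psi> (at (\<sigma> (x, y)))) (at (\<sigma> (x, y)))"
          using test_function_differentiable[OF \<psi>(1)] frechet_derivative_works by blast
        ultimately have "((\<lambda>x. \<psi> (\<sigma> (x, y))) has_derivative
            (\<lambda>v. frechet_derivative \<psi> (at (\<sigma> (x, y))) (\<sigma> (v, 0)))) (at x)"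
          by (rule has_derivative_compose)
        moreover have "frechet_derivative \<psi> (at (\<sigma> (x, y))) (\<sigma> (v, 0)) = v *\<^sub>R D (\<sigma> (x, y))" for v
        proof -
          have "\<sigma> (v, 0) = v *\<^sub>R \<sigma> (1, 0)"
            using linear_scale[OF bounded_linear.linear[OF is_flip_bounded_linear[OF \<sigma>]], of v "(1, 0)"] by simp
          then show ?thesis
            using linear_scale[OF linear_frechet_derivative[OF test_function_differentiable[OF \<psi>(1)]]]
            by (simp add: D_def)
        qed
        ultimately show ?thesis by (simp add: has_vector_derivative_def)
      qed
      have "(LINT x|interval_M. D (\<sigma> (x, y)) * cnj (p x) + \<psi> (\<sigma> (x, y)) * cnj (p' x)) =
          \<psi> (\<sigma> (1, y)) * cnj (p 1) - \<psi> (\<sigma> (0, y)) * cnj (p 0)"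
      proof (rule integral_interval_M_FTC)
        show "((\<lambda>x. \<psi> (\<sigma> (x, y)) * cnj (p x)) has_vector_derivative
            D (\<sigma> (x, y)) * cnj (p x) + \<psi> (\<sigma> (x, y)) * cnj (p' x)) (at x)" for x
          using has_vector_derivative_mult[OF D has_vector_derivative_cnj[OF p]]
          by (simp add: add.commute)
        show "continuous_on UNIV (\<lambda>x. D (\<sigma> (x, y)) * cnj (p x) + \<psi> (\<sigma> (x, y)) * cnj (p' x))"
          by (intro continuous_intros continuous_on_compose2[OF Dc sc] continuous_on_compose2[OF \<psi>c sc] pc p') auto
      qed
      also have "\<dots> = 0"
        using test_function_eq_0[OF \<psi>(1), of "\<sigma> (1, y)"] test_function_eq_0[OF \<psi>(1), of "\<sigma> (0, y)"]
          is_flip_square[OF \<sigma>] by simp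
      finally show ?thesis by (simp add: h_flip)
    qed
    have hs: "integrable square_M (\<lambda>z. h (\<sigma> z))"
      using integrable_distr_eq[OF is_flip_measurable[OF \<sigma>] borel_measurable_integrable[OF h]] h
      unfolding is_flip_distr[OF \<sigma>] by simp
    have "(LINT z|square_M. h z) = (LINT z|square_M. h (\<sigma> z))"
      using flip_integral[OF \<sigma> borel_measurable_integrable[OF h]] by simp
    \<comment> \<open>This order of integration makes the differentiated variable the inner
      one.\<close>
    also have "\<dots> = (LINT y|interval_M. LINT x|interval_M. h (\<sigma> (x, y)))"
      using square.integral_snd[of "\<lambda>x y. h (\<sigma> (x, y))"] hs
      by (simp add: square_M_def case_prod_unfold)
    also have "\<dots> = (LINT y|interval_M. 0)"
      by (rule Bochner_Integration.integral_cong) (use inner0 in auto)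
    finally have "(LINT z|square_M. h z) = 0" by simp
    then have *: "L2_inner square_M D (ftensor \<sigma> p g) = - L2_inner square_M \<psi> (ftensor \<sigma> p' g)"
      unfolding h_def L2_inner_def
      by (subst (asm) Bochner_Integration.integral_add)
        (auto intro: L2_inner_integrable DL \<psi>L u u' simp: add_eq_0_iff2)
    have "L2_inner square_M k (ftensor \<sigma> p g) = L2_inner square_M (\<lambda>z. (1 / \<i>) * D z) (ftensor \<sigma> p g)"
      using \<psi>(3) by (intro L2_inner_cong_AE L u L2_scale DL) (simp add: D_def)
    also have "\<dots> = (1 / \<i>) * L2_inner square_M D (ftensor \<sigma> p g)"
      by (simp add: L2_inner_def mult.assoc)
    \<comment> \<open>The minus sign of the integration by parts is absorbed by conjugation, since
      cnj (1/i) = -(1/i).\<close>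
    also have "\<dots> = L2_inner square_M \<psi> (\<lambda>z. (1 / \<i>) * ftensor \<sigma> p' g z)"
      unfolding * by (simp add: L2_inner_def mult.left_commute)
    also have "\<dots> = L2_inner square_M f (\<lambda>z. (1 / \<i>) * ftensor \<sigma> p' g z)"
      by (intro L2_inner_cong_AE[symmetric] L \<psi> \<psi>L L2_scale u')
    finally show ?thesis .
  qed
  show ?thesis
    using u L2_scale[OF u'] inner by (rule max_momentumI)
qed

lemma max_momentum_add:
  assumes "(f, k) \<in> max_momentum v" "(f', k') \<in> max_momentum v"
  shows "(\<lambda>z. f z + f' z, \<lambda>z. k z + k' z) \<in> max_momentum v"
proof -
  have add: "L2_inner square_M a (\<lambda>z. b z + c z) = L2_inner square_M a b + L2_inner square_M a c"
    if "a \<in> L2 square_M" "b \<in> L2 square_M" "c \<in> L2 square_M" for a b c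
    unfolding L2_inner_def using L2_inner_integrable[OF that(1,2)] L2_inner_integrable[OF that(1,3)]
    by (simp add: distrib_left)
  show ?thesis
  proof (rule max_momentumI)
    fix a b assume ab: "(a, b) \<in> min_momentum v"
    then have "a \<in> L2 square_M" "b \<in> L2 square_M" by (simp_all add: min_momentum_def)
    then show "L2_inner square_M b (\<lambda>z. f z + f' z) = L2_inner square_M a (\<lambda>z. k z + k' z)"
      using assms by (simp add: add max_momentum_L2 max_momentum_inner[OF _ ab])
  qed (intro L2_add max_momentum_L2[OF assms(1)] max_momentum_L2[OF assms(2)])+
qed

text \<open>The adjoint of a densely defined operator is single-valued: two candidate images have
  equal inner products with every test function.\<close>

lemma max_momentum_unique:
  assumes "(f, k) \<in> max_momentum v" "(f, k') \<in> max_momentum v"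
  shows "L2_eq square_M k k'"
proof -
  have L: "k \<in> L2 square_M" "k' \<in> L2 square_M"
    using assms by (auto intro: max_momentum_L2)
  have "AE p in square_M. cnj (k p - k' p) = 0"
  proof (rule test_functions_separate)
    show "(\<lambda>p. cnj (k p - k' p)) \<in> L2 square_M" using L by (intro L2_cnj L2_diff)
    fix \<psi> assume \<psi>: "\<psi> \<in> test_functions" "\<psi> \<in> L2 square_M"
    have "L2_inner square_M \<psi> k = L2_inner square_M \<psi> k'"
      using assms[THEN max_momentum_inner, OF test_function_in_min_momentum[OF \<psi>(1)]] by simp
    then show "(LINT p|square_M. \<psi> p * cnj (k p - k' p)) = 0"
      using L2_inner_integrable[OF \<psi>(2) L(1)] L2_inner_integrable[OF \<psi>(2) L(2)]
      by (simp add: L2_inner_def right_diff_distrib)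
  qed
  then show ?thesis by (simp add: L2_eq_def)
qed

text \<open>The slices depend on t only through the continuous scalars \<open>p t\<close> and
  \<open>q t\<close>, so the given function is its own continuous representative.\<close>

lemma has_boundary_values_separated:
  assumes p: "continuous_on UNIV p" and q: "continuous_on UNIV q"
    and g: "g \<in> L2 interval_M" and h: "h \<in> L2 interval_M"
  shows "has_boundary_values (\<lambda>t z. p t * g z + q t * h z)
    (\<lambda>z. p 0 * g z + q 0 * h z) (\<lambda>z. p 1 * g z + q 1 * h z)"
  unfolding has_boundary_values_def
proof (intro exI[of _ "\<lambda>t z. p t * g z + q t * h z"] conjI ballI)
  fix t :: real
  show "(\<lambda>z. p t * g z + q t * h z) \<in> L2 interval_M" using g h by auto
  let ?B = "\<lambda>s. cmod (p s - p t) * L2_norm interval_M g + cmod (q s - q t) * L2_norm interval_M h"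
  have le: "norm (L2_norm interval_M (\<lambda>z. p s * g z + q s * h z - (p t * g z + q t * h z))) \<le> ?B s" for s
    using L2_norm_triangle[OF L2_scale[OF g, of "p s - p t"] L2_scale[OF h, of "q s - q t"]]
    unfolding L2_norm_scale by (simp add: algebra_simps)
  have lim: "(?B \<longlongrightarrow> cmod (p t - p t) * L2_norm interval_M g + cmod (q t - q t) * L2_norm interval_M h)
      (at t within {0..1})"
  proof -
    have "(r \<longlongrightarrow> r t) (at t within {0..1})" if "continuous_on UNIV r" for r :: "real \<Rightarrow> complex"
      by (rule tendsto_within_subset[of _ _ _ UNIV])
        (use that in \<open>simp_all add: continuous_on_eq_continuous_at isCont_def\<close>)
    from this[OF p] this[OF q] show ?thesis by (intro tendsto_intros)
  qed
  show "((\<lambda>s. L2_norm interval_M (\<lambda>z. p s * g z + q s * h z - (p t * g z + q t * h z))) \<longlongrightarrow> 0)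
      (at t within {0..1})"
    by (rule Lim_null_comparison[OF always_eventually[OF allI[OF le]]]) (use lim in simp)
qed (simp_all add: L2_eq_def)

subsection \<open>Orbits of unitary groups\<close>

lemma unitary_group_unitary: "unitary_group M U \<Longrightarrow> L2_unitary M (U s)"
  by (simp add: unitary_group_def)

text \<open>The distance \<open>N\<close> between the curve and the orbit changes over a time h by
  at most the norm of \<open>\<phi> (s + h) - U h (\<phi> s)\<close>. This is o(h), because both
  terms leave \<open>\<phi> s\<close> with velocity \<open>\<phi>' s\<close>. So \<open>N\<close>
  has derivative 0, and it starts at 0.\<close>

lemma unitary_group_orbit_unique:
  assumes U: "unitary_group M U"
    and \<phi>: "\<And>s. \<phi> s \<in> L2 M" and \<phi>': "\<And>s. \<phi>' s \<in> L2 M"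
    and gen: "\<And>s. 0 \<le> s \<Longrightarrow> s \<le> 1 \<Longrightarrow> (\<phi> s, \<lambda>x. (1 / \<i>) * \<phi>' s x) \<in> generator M U"
    and deriv: "\<And>s. 0 \<le> s \<Longrightarrow> s \<le> 1 \<Longrightarrow>
      ((\<lambda>h. L2_norm M (\<lambda>x. (\<phi> (s + h) x - \<phi> s x) / of_real h - \<phi>' s x)) \<longlongrightarrow> 0) (at 0)"
    and s: "0 \<le> s" "s \<le> 1"
  shows "L2_eq M (U s (\<phi> 0)) (\<phi> s)"
proof -
  note uni = unitary_group_unitary[OF U]
  note UL = L2_unitary_closed[OF uni]
  define N where "N = (\<lambda>s. L2_norm M (\<lambda>x. \<phi> s x - U s (\<phi> 0) x))"
  have "(N has_real_derivative 0) (at s within {0..1})" if s: "s \<in> {0..1}" for s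
  proof -
    let ?\<delta> = "\<lambda>h. L2_norm M (\<lambda>x. \<phi> (s + h) x - U h (\<phi> s) x)"
    let ?a = "\<lambda>h. L2_norm M (\<lambda>x. (\<phi> (s + h) x - \<phi> s x) / of_real h - \<phi>' s x)"
    let ?b = "\<lambda>h. L2_norm M (\<lambda>x. (U h (\<phi> s) x - \<phi> s x) / (\<i> * of_real h) - (1 / \<i>) * \<phi>' s x)"
    have \<delta>: "?\<delta> h \<le> \<bar>h\<bar> * (?a h + ?b h)" if h: "h \<noteq> 0" for h
    proof -
      let ?A = "\<lambda>x. (\<phi> (s + h) x - \<phi> s x) / of_real h - \<phi>' s x"
      let ?B = "\<lambda>x. (U h (\<phi> s) x - \<phi> s x) / (\<i> * of_real h) - (1 / \<i>) * \<phi>' s x"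
      have A: "?A \<in> L2 M" "?B \<in> L2 M"
        using L2_diff[OF L2_scale[OF L2_diff[OF \<phi> \<phi>], of "1 / of_real h"] \<phi>', of "s + h" s s]
          L2_diff[OF L2_scale[OF L2_diff[OF UL[OF \<phi>] \<phi>], of "1 / (\<i> * of_real h)"] L2_scale[OF \<phi>'], of h s s "1 / \<i>" s]
        by simp_all
      \<comment> \<open>The factor -i undoes the 1/i in the generator, so that
        \<open>\<phi> s\<close> and \<open>\<phi>' s\<close> both cancel.\<close>
      have "(\<lambda>x. \<phi> (s + h) x - U h (\<phi> s) x) = (\<lambda>x. of_real h * (?A x + (- \<i>) * ?B x))"
        using h by (simp add: fun_eq_iff field_simps)
      then have "?\<delta> h = \<bar>h\<bar> * L2_norm M (\<lambda>x. ?A x + (- \<i>) * ?B x)"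
        using L2_norm_scale[of M "of_real h"] by simp
      also have "\<dots> \<le> \<bar>h\<bar> * (?a h + ?b h)"
        using L2_norm_triangle[OF A(1) L2_scale[OF A(2), of "- \<i>"]] unfolding L2_norm_scale
        by (intro mult_left_mono) simp_all
      finally show ?thesis .
    qed
    have N: "\<bar>N (s + h) - N s\<bar> \<le> ?\<delta> h" for h
    proof -
      have c: "U s (\<phi> 0) \<in> L2 M" by (intro UL \<phi>)
      have "L2_eq M (U (s + h) (\<phi> 0)) (U h (U s (\<phi> 0)))"
        using U \<phi> unfolding unitary_group_def by (metis add.commute)
      then have "N (s + h) = L2_norm M (\<lambda>x. \<phi> (s + h) x - U h (U s (\<phi> 0)) x)"
        unfolding N_def
        by (intro L2_norm_cong_AE L2_measurable L2_diff UL \<phi>) (auto simp: L2_eq_def elim!: AE_mp)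
      \<comment> \<open>Isometry moves the distance at time s forward by \<open>U h\<close>, so both
        distances are measured to the same orbit point.\<close>
      moreover have "N s = L2_norm M (\<lambda>x. U h (\<phi> s) x - U h (U s (\<phi> 0)) x)"
        unfolding N_def by (rule L2_unitary_norm_diff[OF uni \<phi> c, symmetric])
      moreover have "?\<delta> h = L2_norm M (\<lambda>x. U h (\<phi> s) x - \<phi> (s + h) x)"
        by (rule L2_norm_minus_commute)
      ultimately show ?thesis
        using L2_norm_triangle_diff[OF \<phi> UL[OF \<phi>] UL[OF c], of "s + h" h h s]
          L2_norm_triangle_diff[OF UL[OF \<phi>] \<phi> UL[OF c], of h s h "s + h"] by linarith
    qed
    have lim: "((\<lambda>h. ?a h + ?b h) \<longlongrightarrow> 0 + 0) (at 0)"
      using s gen[of s] by (intro tendsto_add deriv) (auto simp: generator_def)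
    have bd: "\<forall>\<^sub>F h in at 0. norm ((N (s + h) - N s) / h) \<le> ?a h + ?b h"
    proof (rule eventually_at_filter[THEN iffD2, OF always_eventually], intro allI impI)
      fix h :: real assume "h \<noteq> 0"
      then show "norm ((N (s + h) - N s) / h) \<le> ?a h + ?b h"
        using order_trans[OF N \<delta>, of h] by (simp add: field_simps)
    qed
    have "((\<lambda>h. (N (s + h) - N s) / h) \<longlongrightarrow> 0) (at 0)"
      by (rule Lim_null_comparison[OF bd lim[unfolded add_0_right]])
    then show ?thesis
      by (simp add: DERIV_def has_field_derivative_at_within)
  qed
  then obtain c where c: "\<And>s. s \<in> {0..1} \<Longrightarrow> N s = c"
    using has_field_derivative_zero_constant[of "{0..1}" N] by auto
  have "L2_eq M (U 0 (\<phi> 0)) (\<phi> 0)" using U \<phi> by (simp add: unitary_group_def)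
  then have "N 0 = L2_norm M (\<lambda>_. 0)"
    unfolding N_def
    by (intro L2_norm_cong_AE borel_measurable_const L2_measurable[OF L2_diff] UL \<phi>)
      (auto simp: L2_eq_def elim!: AE_mp)
  then have "N s = 0" using c[of 0] c[of s] s by (simp add: L2_norm_def)
  then show ?thesis
    unfolding N_def by (intro L2_eq_sym[OF L2_eq_if_norm_diff_0] \<phi> UL)
qed

subsection \<open>The flow on tensors\<close>

text \<open>The value \<open>f (x + s)\<close> counts only if \<open>x + s\<close> lies in the interval, because a representative
  of an element of \<open>L\<^sup>2(I)\<close> is arbitrary elsewhere.\<close>

definition shift :: "real \<Rightarrow> (real \<Rightarrow> complex) \<Rightarrow> real \<Rightarrow> complex" where
  "shift s f x = (if x + s \<in> {0<..<1} then f (x + s) else 0)"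

text \<open>After extension by zero to the line, translation preserves the integral and the cut-off
  to the interval can only decrease it.\<close>

lemma shift_L2:
  assumes f: "f \<in> L2 interval_M"
  shows "shift s f \<in> L2 interval_M"
    and shift_norm: "L2_norm interval_M (shift s f) \<le> L2_norm interval_M f"
proof -
  let ?q = "\<lambda>x. indicator {0<..<1} x *\<^sub>R (cmod (f x))\<^sup>2"
  \<comment> \<open>Written in the shape of the affine substitution rule for Lebesgue
    measure.\<close>
  let ?q' = "\<lambda>x. ?q (s + 1 * x)"
  have m: "(\<lambda>x. indicator {0<..<1} x *\<^sub>R f x) \<in> borel_measurable borel"
    using L2_measurable[OF f] unfolding interval_M_def by (subst (asm) borel_measurable_restrict_space_iff) auto
  have "shift s f = (\<lambda>x. (\<lambda>x. indicator {0<..<1} x *\<^sub>R f x) (x + s))"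
    by (auto simp: shift_def indicator_def)
  then have sm: "shift s f \<in> borel_measurable interval_M"
    using measurable_compose[OF borel_measurable_add[OF measurable_ident_sets[OF refl] borel_measurable_const] m]
    by (auto intro: interval_M_measurable_borel)
  have int: "integrable lborel ?q"
    using L2_integrable_square[OF f] unfolding interval_M_def by (subst (asm) integrable_restrict_space) auto
  then have int': "integrable lborel ?q'"
    by (rule lborel_integrable_real_affine) simp
  have eq: "indicator {0<..<1} x *\<^sub>R (cmod (shift s f x))\<^sup>2 = indicator {0<..<1} x *\<^sub>R ?q' x" for x
    by (auto simp: shift_def indicator_def add.commute)
  have int'': "integrable lborel (\<lambda>x. indicator {0<..<1} x *\<^sub>R ?q' x)"
    using integrable_mult_indicator[OF _ int'] by simp
  show "shift s f \<in> L2 interval_M"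
    using sm int'' unfolding L2_def eq[symmetric] interval_M_def
    by (subst (asm) integrable_restrict_space[symmetric]) (auto simp: interval_M_def)
  have "(LINT x|interval_M. (cmod (shift s f x))\<^sup>2) = (LINT x|lborel. indicator {0<..<1} x *\<^sub>R ?q' x)"
    unfolding interval_M_def eq[symmetric] by (rule integral_restrict_space) simp
  also have "\<dots> \<le> (LINT x|lborel. ?q' x)"
    by (intro integral_mono int' int'') (auto simp: indicator_def)
  also have "\<dots> = (LINT x|lborel. ?q x)"
    using lborel_integral_real_affine[of 1 ?q s] by simp
  also have "\<dots> = (LINT x|interval_M. (cmod (f x))\<^sup>2)"
    unfolding interval_M_def by (rule integral_restrict_space[symmetric]) simp
  finally show "L2_norm interval_M (shift s f) \<le> L2_norm interval_M f"
    by (simp add: L2_norm_def)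
qed

lemma shift_lincomb: "shift s (\<lambda>x. u * f x + v * g x) = (\<lambda>x. u * shift s f x + v * shift s g x)"
  by (auto simp: shift_def)

lemma shift_diff: "shift s (\<lambda>x. f x - g x) = (\<lambda>x. shift s f x - shift s g x)"
  by (auto simp: shift_def)

text \<open>Uniform continuity of \<open>p'\<close> on a compact interval makes the difference
  quotients converge uniformly on the interval, hence in L^2; the factor \<open>g\<close> only
  multiplies the norm.\<close>

lemma tendsto_difference_quotient_ftensor:
  assumes \<sigma>: "is_flip \<sigma>" and g: "g \<in> L2 interval_M"
    and p: "\<And>x. (p has_vector_derivative p' x) (at x)" and p': "continuous_on UNIV p'"
  shows "((\<lambda>h. L2_norm square_M (\<lambda>z. (ftensor \<sigma> (\<lambda>x. p (x + (s + h))) g z - ftensor \<sigma> (\<lambda>x. p (x + s)) g z) / of_real h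
      - ftensor \<sigma> (\<lambda>x. p' (x + s)) g z)) \<longlongrightarrow> 0) (at 0)"
proof (rule tendstoI)
  fix \<epsilon> :: real assume \<epsilon>: "\<epsilon> > 0"
  have pc: "continuous_on UNIV p"
    using p by (meson continuous_at_imp_continuous_on has_vector_derivative_continuous)
  \<comment> \<open>The 1 keeps the denominator positive and makes the final estimate
    strict.\<close>
  define e where "e = \<epsilon> / (L2_norm interval_M g + 1)"
  have pos: "L2_norm interval_M g + 1 > 0" using L2_norm_nonneg[of interval_M g] by linarith
  have e: "e > 0" using \<epsilon> pos by (simp add: e_def)
  \<comment> \<open>This range contains every x + s + h with x in the interval and |h| \<le>
    1.\<close>
  have "uniformly_continuous_on {s - 1..s + 2} p'"
    by (intro compact_uniformly_continuous continuous_on_subset[OF p']) auto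
  then obtain d where d: "d > 0"
    "\<And>x y. x \<in> {s - 1..s + 2} \<Longrightarrow> y \<in> {s - 1..s + 2} \<Longrightarrow> dist y x < d \<Longrightarrow> dist (p' y) (p' x) < e"
    unfolding uniformly_continuous_on_def using e by blast
  have quotient: "cmod ((p (x + (s + h)) - p (x + s)) / of_real h - p' (x + s)) \<le> e"
    if h: "h \<noteq> 0" "\<bar>h\<bar> < min d 1" and x: "x \<in> {0<..<1}" for h x
  proof -
    define y where "y = x + s"
    let ?S = "closed_segment y (y + h)"
    \<comment> \<open>Subtracting the linear function of slope \<open>p' y\<close> leaves a
      derivative of size at most e, ready for the mean value inequality.\<close>
    have "((\<lambda>t. p t - t *\<^sub>R p' y) has_derivative (\<lambda>v. v *\<^sub>R (p' t - p' y))) (at t within ?S)" for t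
    proof -
      have "(p has_derivative (\<lambda>v. v *\<^sub>R p' t)) (at t within ?S)"
        by (rule has_derivative_at_withinI[OF p[unfolded has_vector_derivative_def]])
      then have "((\<lambda>t. p t - t *\<^sub>R p' y) has_derivative (\<lambda>v. v *\<^sub>R p' t - v *\<^sub>R p' y)) (at t within ?S)"
        by (intro has_derivative_diff has_derivative_scaleR_left has_derivative_ident)
      then show ?thesis by (simp add: scaleR_diff_right)
    qed
    moreover have "onorm (\<lambda>v. v *\<^sub>R (p' t - p' y)) \<le> e" if "t \<in> ?S" for t
    proof (rule onorm_bound)
      have ty: "\<bar>t - y\<bar> \<le> \<bar>h\<bar>"
        using that by (auto simp: closed_segment_eq_real_ivl split: if_splits)
      then have "dist (p' t) (p' y) < e"
        using h x by (intro d(2)) (auto simp: dist_real_def y_def)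
      then have le: "cmod (p' t - p' y) \<le> e" by (simp add: dist_norm)
      show "norm (v *\<^sub>R (p' t - p' y)) \<le> e * norm v" for v
        unfolding norm_scaleR real_norm_def mult.commute[of e] by (rule mult_left_mono[OF le abs_ge_zero])
    qed (use e in simp)
    ultimately have "norm ((p (y + h) - (y + h) *\<^sub>R p' y) - (p y - y *\<^sub>R p' y)) \<le> e * norm (y + h - y)"
      by (intro differentiable_bound[of ?S "\<lambda>t. p t - t *\<^sub>R p' y" "\<lambda>t v. v *\<^sub>R (p' t - p' y)"]) auto
    then have "cmod (p (y + h) - p y - of_real h * p' y) \<le> e * \<bar>h\<bar>"
      by (simp add: algebra_simps scaleR_conv_of_real)
    moreover have "(p (y + h) - p y) / of_real h - p' y = (p (y + h) - p y - of_real h * p' y) / of_real h"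
      using h by (simp add: field_simps)
    ultimately show ?thesis
      using h by (simp add: norm_divide divide_le_eq y_def add.assoc)
  qed
  have "L2_norm square_M (\<lambda>z. (ftensor \<sigma> (\<lambda>x. p (x + (s + h))) g z - ftensor \<sigma> (\<lambda>x. p (x + s)) g z) / of_real h
      - ftensor \<sigma> (\<lambda>x. p' (x + s)) g z) < \<epsilon>" if h: "h \<noteq> 0" "\<bar>h\<bar> < min d 1" for h
  proof -
    let ?r = "\<lambda>x. (p (x + (s + h)) - p (x + s)) / of_real h - p' (x + s)"
    have rL: "?r \<in> L2 interval_M"
      using h by (intro continuous_L2_interval continuous_intros continuous_on_compose2[OF pc]
          continuous_on_compose2[OF p']) auto
    have eL: "(\<lambda>_. complex_of_real e) \<in> L2 interval_M"
      by (intro continuous_L2_interval continuous_intros)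
    have "(\<lambda>z. (ftensor \<sigma> (\<lambda>x. p (x + (s + h))) g z - ftensor \<sigma> (\<lambda>x. p (x + s)) g z) / of_real h
      - ftensor \<sigma> (\<lambda>x. p' (x + s)) g z) = ftensor \<sigma> ?r g"
      by (auto simp: ftensor_alt fun_eq_iff field_simps diff_divide_distrib)
    then have "L2_norm square_M (\<lambda>z. (ftensor \<sigma> (\<lambda>x. p (x + (s + h))) g z - ftensor \<sigma> (\<lambda>x. p (x + s)) g z) / of_real h
      - ftensor \<sigma> (\<lambda>x. p' (x + s)) g z) = L2_norm interval_M ?r * L2_norm interval_M g"
      by (simp only: L2_norm_ftensor[OF \<sigma> rL g])
    moreover have "L2_norm interval_M ?r \<le> e"
    proof -
      have "measure interval_M {0<..<1} = 1"
        by (simp add: interval_M_def measure_restrict_space)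
      then have "L2_norm interval_M (\<lambda>_. complex_of_real e) = e"
        using e by (simp add: L2_norm_def)
      moreover have "L2_norm interval_M ?r \<le> L2_norm interval_M (\<lambda>_. complex_of_real e)"
        by (rule L2_norm_le_dominated[OF rL eL]) (use quotient[OF h] e in auto)
      ultimately show ?thesis by simp
    qed
    ultimately have "L2_norm square_M (\<lambda>z. (ftensor \<sigma> (\<lambda>x. p (x + (s + h))) g z - ftensor \<sigma> (\<lambda>x. p (x + s)) g z) / of_real h
      - ftensor \<sigma> (\<lambda>x. p' (x + s)) g z) \<le> e * L2_norm interval_M g"
      by (simp only: mult_right_mono[OF _ L2_norm_nonneg])
    also have "\<dots> < e * (L2_norm interval_M g + 1)" using e by simp
    also have "\<dots> = \<epsilon>" using pos by (simp add: e_def)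
    finally show ?thesis .
  qed
  then show "\<forall>\<^sub>F h in at 0. dist (L2_norm square_M (\<lambda>z. (ftensor \<sigma> (\<lambda>x. p (x + (s + h))) g z -
      ftensor \<sigma> (\<lambda>x. p (x + s)) g z) / of_real h - ftensor \<sigma> (\<lambda>x. p' (x + s)) g z)) 0 < \<epsilon>"
    using d(1) by (auto simp: eventually_at dist_real_def intro!: exI[of _ "min d 1"])
qed

section \<open>The flow of one boundary unitary \<open>W\<close>, which acts on the variable
  transversal to the flow\<close>

locale boundary_flow =
  fixes \<sigma> :: "real \<times> real \<Rightarrow> real \<times> real"
    and H :: "(real \<times> real) L2_graph"
    and U :: "real \<Rightarrow> (real \<times> real \<Rightarrow> complex) \<Rightarrow> (real \<times> real \<Rightarrow> complex)"
    and W :: "(real \<Rightarrow> complex) \<Rightarrow> (real \<Rightarrow> complex)"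
  assumes flip: "is_flip \<sigma>"
    and extension: "self_adjoint_extension (\<sigma> (1, 0)) H"
    and group: "unitary_group square_M U"
    and generator: "generator square_M U = H"
    and unitary: "L2_unitary interval_M W"
    and domain: "Domain H = {f \<in> Domain (max_momentum (\<sigma> (1, 0))).
       \<exists>u w. has_boundary_values (\<lambda>t z. f (\<sigma> (t, z))) u w \<and> L2_eq interval_M w (W u)}"
begin

text \<open>Taking adjoints reverses inclusions: \<open>H\<close> contains the minimal operator and
  is its own adjoint, so it lies in the adjoint of the minimal one.\<close>

lemma extension_le_max_momentum:
  assumes "(f, k) \<in> H"
  shows "(f, k) \<in> max_momentum (\<sigma> (1, 0))"
  using assms extension
  unfolding max_momentum_def self_adjoint_extension_def self_adjoint_def L2_adjoint_def by blast

text \<open>The boundary condition places only \<open>f\<close> in the domain. The image under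
  \<open>H\<close> agrees with \<open>k\<close> by uniqueness of the maximal image, and graphs are
  closed under change of representatives.\<close>

lemma max_momentum_in_extension:
  assumes fk: "(f, k) \<in> max_momentum (\<sigma> (1, 0))"
    and bv: "has_boundary_values (\<lambda>t z. f (\<sigma> (t, z))) u w" "L2_eq interval_M w (W u)"
  shows "(f, k) \<in> H"
proof -
  have "f \<in> Domain H" using fk bv unfolding domain by blast
  then obtain k' where k': "(f, k') \<in> H" by blast
  then have "L2_eq square_M k' k"
    using max_momentum_unique[OF extension_le_max_momentum fk] by blast
  then show ?thesis
    using k' extension max_momentum_L2[OF fk] L2_eq_refl[of square_M f]
    unfolding self_adjoint_extension_def self_adjoint_def L2_operator_def by blast
qed

text \<open>Extended by zero, \<open>p\<close> is C^1 on the whole line, so its translates are too.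
  Mass leaving at coordinate 0 re-enters at coordinate 1 transformed by \<open>W\<close>, which is
  exactly the boundary condition.\<close>

lemma flow_smooth:
  assumes p: "\<And>x. (p has_vector_derivative p' x) (at x)" and p': "continuous_on UNIV p'"
    and supp: "\<And>x. x \<notin> {0<..<1} \<Longrightarrow> p x = 0"
    and g: "g \<in> L2 interval_M" and s: "0 \<le> s" "s \<le> 1"
  shows "L2_eq square_M (U s (ftensor \<sigma> p g))
    (\<lambda>z. ftensor \<sigma> (\<lambda>x. p (x + s)) g z + ftensor \<sigma> (\<lambda>x. p (x + (s - 1))) (W g) z)"
proof -
  define \<phi> where "\<phi> = (\<lambda>s z. ftensor \<sigma> (\<lambda>x. p (x + s)) g z + ftensor \<sigma> (\<lambda>x. p (x + (s - 1))) (W g) z)"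
  define \<phi>' where "\<phi>' = (\<lambda>s z. ftensor \<sigma> (\<lambda>x. p' (x + s)) g z + ftensor \<sigma> (\<lambda>x. p' (x + (s - 1))) (W g) z)"
  have Wg: "W g \<in> L2 interval_M" using unitary g by (rule L2_unitary_closed)
  have pc: "continuous_on UNIV p"
    using p by (meson continuous_at_imp_continuous_on has_vector_derivative_continuous)
  have pa: "continuous_on UNIV (\<lambda>x. p (x + a))" "continuous_on UNIV (\<lambda>x. p' (x + a))" for a
    by (intro continuous_on_compose2[OF pc] continuous_on_compose2[OF p'] continuous_intros; simp)+
  have pL: "(\<lambda>x. p (x + a)) \<in> L2 interval_M" "(\<lambda>x. p' (x + a)) \<in> L2 interval_M" for a
    by (intro continuous_L2_interval pa)+
  have \<phi>L: "\<phi> s \<in> L2 square_M" "\<phi>' s \<in> L2 square_M" for s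
    unfolding \<phi>_def \<phi>'_def by (intro L2_add ftensor_L2 flip pL g Wg)+
  have orbit: "L2_eq square_M (U s (\<phi> 0)) (\<phi> s)"
  proof (rule unitary_group_orbit_unique[OF group \<phi>L _ _ s])
    fix s :: real assume s: "0 \<le> s" "s \<le> 1"
    have "((\<lambda>x. p (x + a)) has_vector_derivative p' (x + a)) (at x)" for x a
    proof -
      have "((\<lambda>x. x + a) has_vector_derivative 1) (at x)"
        by (auto intro!: derivative_eq_intros)
      from vector_diff_chain_at[OF this p] show ?thesis by (simp add: o_def)
    qed
    then have "(ftensor \<sigma> (\<lambda>x. p (x + a)) h, \<lambda>z. (1 / \<i>) * ftensor \<sigma> (\<lambda>x. p' (x + a)) h z) \<in> max_momentum (\<sigma> (1, 0))"
      if "h \<in> L2 interval_M" for a h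
      using that by (intro max_momentum_ftensor flip pa)
    from max_momentum_add[OF this[OF g, of s] this[OF Wg, of "s - 1"]]
    have "(\<phi> s, \<lambda>z. (1 / \<i>) * \<phi>' s z) \<in> max_momentum (\<sigma> (1, 0))"
      by (simp add: \<phi>_def \<phi>'_def distrib_left)
    moreover have "has_boundary_values (\<lambda>t z. \<phi> s (\<sigma> (t, z))) (\<lambda>z. p (0 + s) * g z + p (0 + (s - 1)) * W g z)
        (\<lambda>z. p (1 + s) * g z + p (1 + (s - 1)) * W g z)"
      using has_boundary_values_separated[OF pa(1)[of s] pa(1)[of "s - 1"] g Wg]
      by (simp add: \<phi>_def ftensor_alt is_flip_involution[OF flip])
    moreover have "L2_eq interval_M (\<lambda>z. p (1 + s) * g z + p (1 + (s - 1)) * W g z)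
        (W (\<lambda>z. p (0 + s) * g z + p (0 + (s - 1)) * W g z))"
    proof -
      \<comment> \<open>Both arguments lie outside the open interval, so the boundary values reduce
        to \<open>p s\<close> times \<open>g\<close> at 0 and \<open>p s\<close> times
        \<open>W g\<close> at 1.\<close>
      have "p (1 + s) = 0" "p (s - 1) = 0" using s by (auto intro!: supp)
      then show ?thesis using L2_eq_sym[OF L2_unitary_scale[OF unitary g, of "p s"]] by simp
    qed
    ultimately show "(\<phi> s, \<lambda>z. (1 / \<i>) * \<phi>' s z) \<in> generator square_M U"
      unfolding generator by (rule max_momentum_in_extension)
    let ?Q = "\<lambda>s g h z. (ftensor \<sigma> (\<lambda>x. p (x + (s + h))) g z - ftensor \<sigma> (\<lambda>x. p (x + s)) g z) / of_real h
      - ftensor \<sigma> (\<lambda>x. p' (x + s)) g z"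
    have QL: "?Q a k h \<in> L2 square_M" if "k \<in> L2 interval_M" for a k h
      using L2_diff[OF L2_scale[OF L2_diff[OF ftensor_L2[OF flip pL(1) that] ftensor_L2[OF flip pL(1) that]],
          of "1 / of_real h"] ftensor_L2[OF flip pL(2) that], of "a + h" a a] by simp
    \<comment> \<open>Since (s + h) - 1 = (s - 1) + h, the wrapped term is the same kind of quotient
      at time s - 1.\<close>
    have eq: "(\<lambda>z. (\<phi> (s + h) z - \<phi> s z) / of_real h - \<phi>' s z) = (\<lambda>z. ?Q s g h z + ?Q (s - 1) (W g) h z)" for h
      by (simp add: \<phi>_def \<phi>'_def fun_eq_iff add_divide_distrib diff_divide_distrib algebra_simps)
    have le: "norm (L2_norm square_M (\<lambda>z. (\<phi> (s + h) z - \<phi> s z) / of_real h - \<phi>' s z)) \<le>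
        L2_norm square_M (?Q s g h) + L2_norm square_M (?Q (s - 1) (W g) h)" for h
      unfolding eq using L2_norm_triangle[OF QL[OF g] QL[OF Wg]] by simp
    have lim: "((\<lambda>h. L2_norm square_M (?Q s g h) + L2_norm square_M (?Q (s - 1) (W g) h)) \<longlongrightarrow> 0 + 0) (at 0)"
      by (intro tendsto_add tendsto_difference_quotient_ftensor[OF flip] g Wg p p')
    show "((\<lambda>h. L2_norm square_M (\<lambda>z. (\<phi> (s + h) z - \<phi> s z) / of_real h - \<phi>' s z)) \<longlongrightarrow> 0) (at 0)"
      by (rule Lim_null_comparison[OF always_eventually[OF allI[OF le]] lim[unfolded add_0_right]])
  qed
  have initial: "L2_eq square_M (ftensor \<sigma> p g) (\<phi> 0)"
  proof -
    have "ftensor \<sigma> p g z = \<phi> 0 z" if "z \<in> space square_M" for z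
    proof -
      have "\<sigma> z \<in> {0<..<1} \<times> {0<..<1}" using that is_flip_square[OF flip] by simp
      then have "p (fst (\<sigma> z) + (0 - 1)) = 0" by (intro supp) auto
      then show ?thesis by (simp add: \<phi>_def ftensor_alt)
    qed
    then show ?thesis unfolding L2_eq_def by (rule AE_I2)
  qed
  have "p \<in> L2 interval_M" using pL(1)[of 0] by simp
  then have "L2_eq square_M (U s (ftensor \<sigma> p g)) (U s (\<phi> 0))"
    by (intro L2_unitary_cong[OF unitary_group_unitary[OF group] _ \<phi>L(1) initial] ftensor_L2 flip g)
  from L2_eq_trans[OF this orbit] show ?thesis by (simp only: \<phi>_def)
qed

text \<open>Both sides are linear and bounded in \<open>f\<close>, the left by isometry and the
  right because shifts do not increase norms; so the smooth case extends by density of the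
  bumps.\<close>

lemma flow_tensor:
  assumes f: "f \<in> L2 interval_M" and g: "g \<in> L2 interval_M" and s: "0 \<le> s" "s \<le> 1"
  shows "L2_eq square_M (U s (ftensor \<sigma> f g))
    (\<lambda>z. ftensor \<sigma> (shift s f) g z + ftensor \<sigma> (shift (s - 1) f) (W g) z)"
proof -
  note uni = unitary_group_unitary[OF group]
  have Wg: "W g \<in> L2 interval_M" using unitary g by (rule L2_unitary_closed)
  have RL: "(\<lambda>z. ftensor \<sigma> (shift s f) g z + ftensor \<sigma> (shift (s - 1) f) (W g) z) \<in> L2 square_M"
    if "f \<in> L2 interval_M" for f
    by (intro L2_add ftensor_L2 flip shift_L2 that g Wg)
  show ?thesis using f
  proof (induction rule: L2_interval_bump_induct)
    case (bump c a b)
    obtain b' where b': "\<And>x. (bump c a b has_vector_derivative b' x) (at x)" "continuous_on UNIV b'"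
      using bump_has_derivative[of c a b] by blast
    have supp: "bump c a b x = 0" if "x \<notin> {0<..<1}" for x
    proof (rule bump_eq_0)
      have "0 < 1 / c" using bump by simp
      then show "x \<le> a + 1 / c \<or> b - 1 / c \<le> x" using that bump
        unfolding greaterThanLessThan_iff by linarith
    qed (rule bump)
    \<comment> \<open>Vanishing outside the interval makes the cut-off invisible.\<close>
    then have "shift r (bump c a b) = (\<lambda>x. bump c a b (x + r))" for r
      by (auto simp: shift_def)
    then show ?case
      using flow_smooth[OF b' supp g s] by simp
  next
    case (lincomb f1 f2 u v)
    have eq: "ftensor \<sigma> (\<lambda>x. u * h1 x + v * h2 x) k = (\<lambda>z. u * ftensor \<sigma> h1 k z + v * ftensor \<sigma> h2 k z)" for h1 h2 k
      by (simp add: ftensor_alt fun_eq_iff algebra_simps)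
    have "L2_eq square_M (U s (ftensor \<sigma> (\<lambda>x. u * f1 x + v * f2 x) g))
        (\<lambda>z. u * U s (ftensor \<sigma> f1 g) z + v * U s (ftensor \<sigma> f2 g) z)"
      unfolding eq by (intro L2_unitary_linear[OF uni] ftensor_L2 flip lincomb g)
    moreover have "L2_eq square_M (\<lambda>z. u * U s (ftensor \<sigma> f1 g) z + v * U s (ftensor \<sigma> f2 g) z)
        (\<lambda>z. u * (ftensor \<sigma> (shift s f1) g z + ftensor \<sigma> (shift (s - 1) f1) (W g) z) +
          v * (ftensor \<sigma> (shift s f2) g z + ftensor \<sigma> (shift (s - 1) f2) (W g) z))"
      by (intro L2_eq_lincomb lincomb)
    ultimately show ?case
      using L2_eq_trans by (fastforce simp: shift_lincomb eq algebra_simps)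
  next
    case (lim F f)
    let ?R = "\<lambda>f z. ftensor \<sigma> (shift s f) g z + ftensor \<sigma> (shift (s - 1) f) (W g) z"
    have eq: "(\<lambda>z. ftensor \<sigma> f1 k z - ftensor \<sigma> f2 k z) = ftensor \<sigma> (\<lambda>x. f1 x - f2 x) k" for f1 f2 k
      by (simp add: ftensor_alt fun_eq_iff algebra_simps)
    show ?case
    proof (rule L2_eq_limit[where F = "\<lambda>n. U s (ftensor \<sigma> (F n) g)" and G = "\<lambda>n. ?R (F n)"])
      have "L2_norm square_M (\<lambda>z. U s (ftensor \<sigma> (F n) g) z - U s (ftensor \<sigma> f g) z) =
          L2_norm interval_M (\<lambda>x. F n x - f x) * L2_norm interval_M g" for n
        using L2_unitary_norm_diff[OF uni ftensor_L2[OF flip _ g] ftensor_L2[OF flip _ g], of "F n" f s] lim.hyps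
        by (simp add: eq L2_norm_ftensor flip g L2_diff)
      then show "(\<lambda>n. L2_norm square_M (\<lambda>z. U s (ftensor \<sigma> (F n) g) z - U s (ftensor \<sigma> f g) z)) \<longlonglongrightarrow> 0"
        using tendsto_mult_left_zero[OF lim.hyps(3)] by simp
      let ?d = "\<lambda>n. L2_norm interval_M (\<lambda>x. F n x - f x)"
      have le: "norm (L2_norm square_M (\<lambda>z. ?R (F n) z - ?R f z)) \<le> ?d n * (L2_norm interval_M g + L2_norm interval_M (W g))" for n
      proof -
        have D: "(\<lambda>x. F n x - f x) \<in> L2 interval_M" using lim.hyps by auto
        have "(\<lambda>z. ?R (F n) z - ?R f z) = (\<lambda>z. ftensor \<sigma> (shift s (\<lambda>x. F n x - f x)) g z +
            ftensor \<sigma> (shift (s - 1) (\<lambda>x. F n x - f x)) (W g) z)"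
          by (simp add: shift_diff ftensor_alt fun_eq_iff algebra_simps)
        then have "L2_norm square_M (\<lambda>z. ?R (F n) z - ?R f z) \<le>
            L2_norm square_M (ftensor \<sigma> (shift s (\<lambda>x. F n x - f x)) g) +
            L2_norm square_M (ftensor \<sigma> (shift (s - 1) (\<lambda>x. F n x - f x)) (W g))"
          using L2_norm_triangle[OF ftensor_L2[OF flip shift_L2(1)[OF D] g] ftensor_L2[OF flip shift_L2(1)[OF D] Wg]] by simp
        also have "\<dots> \<le> ?d n * L2_norm interval_M g + ?d n * L2_norm interval_M (W g)"
          using shift_norm[OF D]
          by (auto simp: L2_norm_ftensor flip shift_L2(1)[OF D] g Wg intro!: add_mono mult_right_mono)
        finally show ?thesis by (simp add: distrib_left)
      qed
      show "(\<lambda>n. L2_norm square_M (\<lambda>z. ?R (F n) z - ?R f z)) \<longlonglongrightarrow> 0"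
        by (rule Lim_null_comparison[OF always_eventually[OF allI[OF le]] tendsto_mult_left_zero[OF lim.hyps(3)]])
    qed (use lim in \<open>auto intro!: L2_unitary_closed[OF uni] ftensor_L2 flip g RL\<close>)
  qed
qed

end

subsection \<open>Commuting flows\<close>

lemma L2_cong:
  assumes eq: "\<And>x. x \<in> space M \<Longrightarrow> f x = g x" and g: "g \<in> L2 M"
  shows "f \<in> L2 M"
proof (rule L2_dominated[OF _ L2_integrable_square[OF g]])
  show "f \<in> borel_measurable M"
    using measurable_cong[THEN iffD2, OF eq L2_measurable[OF g]] .
qed (simp add: eq)

lemma AE_interval_neq: "AE x in interval_M. x \<noteq> a"
  unfolding interval_M_def
  using AE_lborel_singleton[of a] by (subst AE_restrict_space_iff) (auto elim: eventually_mono)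

lemma periodic_translation_frac: "periodic_translation (frac t) f = periodic_translation t f"
proof -
  have "frac (x + frac t) = frac (x + t)" for x
  proof -
    have "x + t = x + frac t + of_int \<lfloor>t\<rfloor>" by (simp add: frac_def)
    then show ?thesis by (simp only: frac_add_of_int_right)
  qed
  then show ?thesis by (simp add: periodic_translation_def)
qed

lemma periodic_translation_shift:
  assumes s: "0 \<le> s" "s < 1" and f: "f \<in> L2 interval_M"
  shows periodic_translation_L2: "periodic_translation s f \<in> L2 interval_M"
    and periodic_translation_eq_shift:
      "L2_eq interval_M (periodic_translation s f) (\<lambda>x. shift s f x + shift (s - 1) f x)"
proof -
  \<comment> \<open>At x = 1 - s the fractional part is 0, where the representative has an arbitrary
    value \<open>f 0\<close>; the correction term records this single point.\<close>
  have eq: "periodic_translation s f x = (shift s f x + shift (s - 1) f x) + (if x = 1 - s then f 0 else 0)"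
    if x: "x \<in> {0<..<1}" for x
  proof (cases "x + s" "1 :: real" rule: linorder_cases)
    case less
    then have "frac (x + s) = x + s" using x s by (simp add: frac_eq)
    then show ?thesis using less x s by (auto simp: periodic_translation_def shift_def)
  next
    case equal
    then show ?thesis by (auto simp: periodic_translation_def shift_def)
  next
    case greater
    then have "frac (x + s) = x + s - 1" using x s by (simp add: frac_unique_iff)
    then show ?thesis using greater x s by (auto simp: periodic_translation_def shift_def add_diff_eq)
  qed
  have "(\<lambda>x. if x = 1 - s then f 0 else 0) \<in> L2 interval_M"
    by (rule bounded_L2[OF interval.finite_measure_axioms, where B = "cmod (f 0)"])
      (auto intro!: interval_M_measurable_borel)
  then show "periodic_translation s f \<in> L2 interval_M"
    using eq f by (intro L2_cong[OF eq] L2_add shift_L2(1)) auto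
  have "AE x in interval_M. x \<in> space interval_M" by (rule AE_space)
  then show "L2_eq interval_M (periodic_translation s f) (\<lambda>x. shift s f x + shift (s - 1) f x)"
    unfolding L2_eq_def using AE_interval_neq[of "1 - s"] by eventually_elim (simp add: eq)
qed

text \<open>The wrap-around formula covers only times in [0,1]. The group law extends the eigenvalue
  relation by iteration to positive times and by inversion to negative ones.\<close>

lemma unitary_group_eigenvector:
  assumes U: "unitary_group M U" and v: "v \<in> L2 M"
    and eig: "\<And>s. 0 \<le> s \<Longrightarrow> s \<le> 1 \<Longrightarrow> L2_eq M (U s v) (\<lambda>x. exp (\<i> * of_real (\<mu> * s)) * v x)"
  shows "L2_eq M (U s v) (\<lambda>x. exp (\<i> * of_real (\<mu> * s)) * v x)"
proof -
  note uni = unitary_group_unitary[OF U]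
  note UL = L2_unitary_closed[OF uni]
  have add: "L2_eq M (U (s + t) v) (U s (U t v))" for s t
    using U v by (simp add: unitary_group_def)
  have zero: "L2_eq M (U 0 v) v"
    using U v by (simp add: unitary_group_def)
  have step: "L2_eq M (U (s + t) v) (\<lambda>x. c * U s v x)" if "L2_eq M (U t v) (\<lambda>x. c * v x)" for s t c
    using L2_eq_trans[OF add L2_eq_trans[OF L2_unitary_cong[OF uni UL[OF v] L2_scale[OF v] that]
          L2_unitary_scale[OF uni v]]] .
  have multiple: "L2_eq M (U (real n * s) v) (\<lambda>x. exp (\<i> * of_real (\<mu> * (real n * s))) * v x)"
    if s: "0 \<le> s" "s \<le> 1" for n s
  proof (induction n)
    case 0
    then show ?case using zero by simp
  next
    case (Suc n)
    have "real (Suc n) * s = s + real n * s" by (simp add: algebra_simps)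
    then have 1: "L2_eq M (U (real (Suc n) * s) v)
        (\<lambda>x. exp (\<i> * of_real (\<mu> * (real n * s))) * U s v x)"
      using step[OF Suc, of s] by (simp only:)
    have 2: "L2_eq M (\<lambda>x. exp (\<i> * of_real (\<mu> * (real n * s))) * U s v x)
        (\<lambda>x. exp (\<i> * of_real (\<mu> * (real n * s))) * (exp (\<i> * of_real (\<mu> * s)) * v x))"
      using eig[OF s] unfolding L2_eq_def by eventually_elim simp
    have "\<mu> * (real (Suc n) * s) = \<mu> * (real n * s) + \<mu> * s"
      by (simp add: algebra_simps)
    then have "exp (\<i> * of_real (\<mu> * (real n * s))) * exp (\<i> * of_real (\<mu> * s)) =
        exp (\<i> * of_real (\<mu> * (real (Suc n) * s)))"
      by (simp only: of_real_add distrib_left exp_add)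
    with L2_eq_trans[OF 1 2] show ?case by (simp only: mult.assoc[symmetric])
  qed
  have nonneg: "L2_eq M (U s v) (\<lambda>x. exp (\<i> * of_real (\<mu> * s)) * v x)" if s: "0 \<le> s" for s
  proof -
    \<comment> \<open>The time s is cut into n equal steps of length below 1.\<close>
    obtain n :: nat where n: "s < real n" using reals_Archimedean2 by blast
    then have "real n * (s / real n) = s" using s by simp
    moreover have "0 \<le> s / real n" "s / real n \<le> 1" using n s by (simp_all add: divide_le_eq)
    ultimately show ?thesis using multiple[of "s / real n" n] by simp
  qed
  show ?thesis
  proof (cases "0 \<le> s")
    case False
    let ?c = "exp (\<i> * of_real (\<mu> * (- s)))"
    \<comment> \<open>Going back by -s is already understood, which expresses \<open>v\<close>
      through \<open>U s v\<close>; the scalar is then inverted.\<close>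
    have "L2_eq M (U (s + - s) v) (\<lambda>x. ?c * U s v x)"
      using False by (intro step nonneg) simp
    then have v_eq: "L2_eq M v (\<lambda>x. ?c * U s v x)"
      using L2_eq_trans[OF L2_eq_sym[OF zero]] by simp
    have inverse: "exp (\<i> * of_real (\<mu> * s)) * ?c = 1"
      unfolding exp_add[symmetric] distrib_left[symmetric] of_real_add[symmetric] by simp
    have key: "U s v x = exp (\<i> * of_real (\<mu> * s)) * v x" if "v x = ?c * U s v x" for x
      by (subst that) (simp only: mult.assoc[symmetric] inverse mult_1_left)
    from v_eq show ?thesis
      unfolding L2_eq_def
    proof eventually_elim
      case (elim x)
      then show ?case by (rule key)
    qed
  qed (rule nonneg)
qed

section \<open>The flow at time one and the eigenvectors for scalar boundary unitaries\<close>

context boundary_flow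
begin

text \<open>At time 1 everything has wrapped exactly once: the unwrapped shift is empty on the
  interval and the wrapped one is the identity.\<close>

lemma flow_one:
  assumes f: "f \<in> L2 interval_M" and g: "g \<in> L2 interval_M"
  shows "L2_eq square_M (U 1 (ftensor \<sigma> f g)) (ftensor \<sigma> f (W g))"
proof -
  have "ftensor \<sigma> (shift 1 f) g z + ftensor \<sigma> (shift (1 - 1) f) (W g) z = ftensor \<sigma> f (W g) z"
    if "z \<in> space square_M" for z
  proof -
    have "\<sigma> z \<in> {0<..<1} \<times> {0<..<1}" using that is_flip_square[OF flip] by simp
    then show ?thesis by (auto simp: ftensor_alt shift_def)
  qed
  then have "L2_eq square_M (\<lambda>z. ftensor \<sigma> (shift 1 f) g z + ftensor \<sigma> (shift (1 - 1) f) (W g) z) (ftensor \<sigma> f (W g))"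
    unfolding L2_eq_def by (rule AE_I2)
  from L2_eq_trans[OF flow_tensor[OF f g] this] show ?thesis by simp
qed

text \<open>Exponentials are multiplicative, so translation by s multiplies by
  \<open>e \<xi> s\<close>; the scalar boundary factor makes the wrapped piece continue the
  unwrapped one.\<close>

lemma flow_eigenvector:
  assumes scalar: "scalar_operator W (exp (\<i> * of_real (2 * pi * \<alpha>)))" and g: "g \<in> L2 interval_M"
  shows "L2_eq square_M (U s (ftensor \<sigma> (e (\<alpha> + of_int m)) g))
    (\<lambda>z. exp (\<i> * of_real (2 * pi * (\<alpha> + of_int m) * s)) * ftensor \<sigma> (e (\<alpha> + of_int m)) g z)"
proof -
  define \<xi> where "\<xi> = \<alpha> + of_int m"
  define c where "c = exp (\<i> * of_real (2 * pi * \<alpha>))"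
  have Wg: "W g \<in> L2 interval_M" using unitary g by (rule L2_unitary_closed)
  have eL: "e \<xi> \<in> L2 interval_M"
    unfolding e_def[abs_def] by (intro continuous_L2_interval continuous_intros)
  have e_add: "e \<xi> (x + y) = e \<xi> x * e \<xi> y" for x y
    unfolding e_def exp_add[symmetric] by (simp add: algebra_simps)
  \<comment> \<open>As \<open>\<xi>\<close> differs from \<open>\<alpha>\<close> by an integer, the
    factor gained at the boundary cancels that of one period.\<close>
  have e_wrap: "c * e \<xi> (- 1) = 1"
  proof -
    have "c * e \<xi> (- 1) = exp (of_real (2 * of_int (- m) * pi) * \<i>)"
    proof -
      have "\<i> * of_real (2 * pi * \<alpha>) + \<i> * of_real (2 * pi * \<xi> * (- 1)) =
          of_real (2 * of_int (- m) * pi) * \<i>"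
        by (simp add: \<xi>_def algebra_simps)
      then show ?thesis unfolding c_def e_def exp_add[symmetric] by (rule arg_cong)
    qed
    also have "\<dots> = 1" by (rule exp_integer_2pi) simp
    finally show ?thesis .
  qed
  have unit: "L2_eq square_M (U s (ftensor \<sigma> (e \<xi>) g)) (\<lambda>z. e \<xi> s * ftensor \<sigma> (e \<xi>) g z)"
    if s: "0 \<le> s" "s \<le> 1" for s
  proof -
    have sL: "shift r (e \<xi>) \<in> L2 interval_M" for r using eL by (rule shift_L2(1))
    have "L2_eq square_M (ftensor \<sigma> (shift (s - 1) (e \<xi>)) (W g)) (ftensor \<sigma> (shift (s - 1) (e \<xi>)) (\<lambda>y. c * g y))"
      using scalar g by (intro L2_eq_ftensor flip sL Wg L2_scale L2_eq_refl) (simp_all add: scalar_operator_def c_def)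
    then have wrap: "L2_eq square_M
        (\<lambda>z. ftensor \<sigma> (shift s (e \<xi>)) g z + ftensor \<sigma> (shift (s - 1) (e \<xi>)) (W g) z)
        (ftensor \<sigma> (\<lambda>x. shift s (e \<xi>) x + c * shift (s - 1) (e \<xi>) x) g)"
      unfolding L2_eq_def by (rule AE_mp) (auto simp: ftensor_alt algebra_simps)
    have "L2_eq interval_M (\<lambda>x. shift s (e \<xi>) x + c * shift (s - 1) (e \<xi>) x) (\<lambda>x. e \<xi> s * e \<xi> x)"
    proof -
      \<comment> \<open>At x = 1 - s both cut-off shifts vanish, hence the excluded point.\<close>
      have eq: "shift s (e \<xi>) x + c * shift (s - 1) (e \<xi>) x = e \<xi> s * e \<xi> x"
        if x: "x \<in> {0<..<1}" "x \<noteq> 1 - s" for x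
      proof (cases "x + s < 1")
        case True
        then have "shift s (e \<xi>) x = e \<xi> (x + s)" "shift (s - 1) (e \<xi>) x = 0"
          using x s by (simp_all add: shift_def)
        then show ?thesis by (simp add: e_add mult.commute)
      next
        case False
        then have "shift s (e \<xi>) x = 0" "shift (s - 1) (e \<xi>) x = e \<xi> ((x + s) + (- 1))"
          using x s by (simp_all add: shift_def add_diff_eq)
        then have "shift s (e \<xi>) x + c * shift (s - 1) (e \<xi>) x = e \<xi> x * e \<xi> s * (c * e \<xi> (- 1))"
          by (simp only: e_add mult_ac add_0_left)
        then show ?thesis by (simp add: e_wrap mult.commute)
      qed
      have "AE x in interval_M. x \<in> space interval_M" by (rule AE_space)
      then show ?thesis
        unfolding L2_eq_def using AE_interval_neq[of "1 - s"]
        by eventually_elim (rule eq, simp_all)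
    qed
    then have "L2_eq square_M (ftensor \<sigma> (\<lambda>x. shift s (e \<xi>) x + c * shift (s - 1) (e \<xi>) x) g)
        (ftensor \<sigma> (\<lambda>x. e \<xi> s * e \<xi> x) g)"
      by (intro L2_eq_ftensor flip L2_add L2_scale sL eL g L2_eq_refl)
    note L2_eq_trans[OF flow_tensor[OF eL g s] L2_eq_trans[OF wrap this]]
    moreover have "ftensor \<sigma> (\<lambda>x. e \<xi> s * e \<xi> x) g = (\<lambda>z. e \<xi> s * ftensor \<sigma> (e \<xi>) g z)"
      by (simp add: ftensor_alt fun_eq_iff)
    ultimately show ?thesis by (simp only:)
  qed
  have "L2_eq square_M (U s (ftensor \<sigma> (e \<xi>) g)) (\<lambda>z. exp (\<i> * of_real ((2 * pi * \<xi>) * s)) * ftensor \<sigma> (e \<xi>) g z)"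
    by (rule unitary_group_eigenvector[OF group ftensor_L2[OF flip eL g]]) (simp only: unit flip: e_def)
  then show ?thesis by (simp add: \<xi>_def)
qed

end

text \<open>Pairing the relation \<open>A \<otimes> g + B \<otimes> h = 0\<close> with \<open>B\<close> makes \<open>h\<close> a multiple of \<open>g\<close>
  whose factor depends only on \<open>A\<close> and \<open>B\<close>.\<close>

lemma tensor_relation:
  assumes \<sigma>: "is_flip \<sigma>"
    and L: "A \<in> L2 interval_M" "B \<in> L2 interval_M" "g \<in> L2 interval_M" "h \<in> L2 interval_M"
    and rel: "L2_eq square_M (\<lambda>z. ftensor \<sigma> A g z + ftensor \<sigma> B h z) (\<lambda>_. 0)"
  shows "L2_eq interval_M (\<lambda>y. L2_inner interval_M A B * g y + L2_inner interval_M B B * h y) (\<lambda>_. 0)"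
proof -
  have m: "(\<lambda>p. tensor A g p + tensor B h p) \<in> borel_measurable square_M"
    by (intro L2_measurable L2_add tensor_L2(1) L)
  then have "AE p in square_M. tensor A g p + tensor B h p = 0"
    using rel flip_L2_eq[OF \<sigma> m, of "\<lambda>_. 0"] by (simp add: L2_eq_def ftensor_def)
  then have "AE y in interval_M. AE x in interval_M. tensor A g (x, y) + tensor B h (x, y) = 0"
    by (rule AE_pair_commute) (use m in measurable)
  then show ?thesis
    unfolding L2_eq_def
  proof eventually_elim
    case (elim y)
    have "L2_inner interval_M A B * g y + L2_inner interval_M B B * h y =
        (LINT x|interval_M. (A x * cnj (B x)) * g y + (B x * cnj (B x)) * h y)"
      using L2_inner_integrable[OF L(1,2)] L2_inner_integrable[OF L(2,2)] by (simp add: L2_inner_def)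
    also have "\<dots> = (LINT x|interval_M. (tensor A g (x, y) + tensor B h (x, y)) * cnj (B x))"
      by (simp add: tensor_def algebra_simps)
    also have "\<dots> = 0"
      using elim by (intro integral_eq_zero_AE) (auto elim!: AE_mp)
    finally show ?case .
  qed
qed

text \<open>Once \<open>B\<close> is null, only the tensor of \<open>A\<close> with the constant 1
  remains, and its norm is that of \<open>A\<close> because 1 has norm 1 on the unit
  interval.\<close>

lemma tensor_relation_left:
  assumes \<sigma>: "is_flip \<sigma>"
    and L: "A \<in> L2 interval_M" "B \<in> L2 interval_M" "h \<in> L2 interval_M"
    and rel: "L2_eq square_M (\<lambda>z. ftensor \<sigma> A (\<lambda>_. 1) z + ftensor \<sigma> B h z) (\<lambda>_. 0)"
    and B: "L2_eq interval_M B (\<lambda>_. 0)"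
  shows "L2_eq interval_M A (\<lambda>_. 0)"
proof -
  have one: "(\<lambda>_. 1) \<in> L2 interval_M" and zero: "(\<lambda>_. 0) \<in> L2 interval_M"
    by (intro continuous_L2_interval continuous_intros)+
  have "L2_eq square_M (ftensor \<sigma> B h) (ftensor \<sigma> (\<lambda>_. 0) h)"
    by (intro L2_eq_ftensor \<sigma> L zero B L2_eq_refl)
  then have "L2_eq square_M (ftensor \<sigma> A (\<lambda>_. 1)) (\<lambda>_. 0)"
    using rel unfolding L2_eq_def by eventually_elim (auto simp: ftensor_alt)
  then have "L2_norm square_M (ftensor \<sigma> A (\<lambda>_. 1)) = L2_norm square_M (\<lambda>_. 0)"
    by (intro L2_norm_cong_AE L2_measurable[OF ftensor_L2] \<sigma> L one) simp
  moreover have "L2_norm interval_M (\<lambda>_. 1) = 1"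
    by (simp add: L2_norm_def interval_M_def measure_restrict_space space_restrict_space)
  ultimately have "L2_norm interval_M A = 0"
    using L2_norm_ftensor[OF \<sigma> L(1) one] by (simp add: L2_norm_def)
  then show ?thesis using L2_norm_eq_0_imp[OF L(1)] by simp
qed

text \<open>The flip of the second flow is composed with the swap, so \<open>W\<close> acts on the
  second tensor factor and \<open>W'\<close> on the first. Exchanging the two flows yields the other
  dichotomy.\<close>

lemma commuting_flows:
  assumes "boundary_flow \<sigma> H U W" and "boundary_flow (prod.swap \<circ> \<sigma>) H' U' W'"
    and commute: "\<And>s t f. f \<in> L2 square_M \<Longrightarrow> L2_eq square_M (U s (U' t f)) (U' t (U s f))"
  shows "(\<exists>a. scalar_operator W a) \<or> commutes_periodic_translation W'"
proof -
  interpret F: boundary_flow \<sigma> H U W by fact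
  interpret F': boundary_flow "prod.swap \<circ> \<sigma>" H' U' W' by fact
  note \<sigma> = F.flip
  note WL = L2_unitary_closed[OF F.unitary]
  note W'L = L2_unitary_closed[OF F'.unitary]
  note uni = unitary_group_unitary[OF F.group]
  note uni' = unitary_group_unitary[OF F'.group]
  have U'1: "L2_eq square_M (U' 1 (ftensor \<sigma> f g)) (ftensor \<sigma> (W' f) g)"
    if "f \<in> L2 interval_M" "g \<in> L2 interval_M" for f g
    using F'.flow_one[OF that(2,1)] by (simp add: ftensor_swap[OF \<sigma>])
  \<comment> \<open>The commutator of \<open>W'\<close> with the cut-off shift by r, applied to
    \<open>f\<close>.\<close>
  define A where "A = (\<lambda>r f x. W' (shift r f) x - shift r (W' f) x)"
  have AL: "A r f \<in> L2 interval_M" if "f \<in> L2 interval_M" for r f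
    unfolding A_def by (intro L2_diff W'L shift_L2(1) that)
  have rel: "L2_eq square_M (\<lambda>z. ftensor \<sigma> (A s f) g z + ftensor \<sigma> (A (s - 1) f) (W g) z) (\<lambda>_. 0)"
    if f: "f \<in> L2 interval_M" and g: "g \<in> L2 interval_M" and s: "0 \<le> s" "s \<le> 1" for f g s
  proof -
    let ?S = "ftensor \<sigma> (shift s f) g" and ?T = "ftensor \<sigma> (shift (s - 1) f) (W g)"
    have L: "?S \<in> L2 square_M" "?T \<in> L2 square_M"
      by (intro ftensor_L2 \<sigma> shift_L2(1) WL f g)+
    have "L2_eq square_M (U' 1 (U s (ftensor \<sigma> f g))) (U' 1 (\<lambda>z. ?S z + ?T z))"
      by (intro L2_unitary_cong[OF uni'] L2_unitary_closed[OF uni] ftensor_L2 \<sigma> f g L2_add L F.flow_tensor s)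
    moreover have "L2_eq square_M (U' 1 (\<lambda>z. ?S z + ?T z)) (\<lambda>z. U' 1 ?S z + U' 1 ?T z)"
      by (intro L2_unitary_add[OF uni'] L)
    moreover have "L2_eq square_M (U' 1 ?S) (ftensor \<sigma> (W' (shift s f)) g)"
      "L2_eq square_M (U' 1 ?T) (ftensor \<sigma> (W' (shift (s - 1) f)) (W g))"
      by (intro U'1 shift_L2(1) WL f g)+
    moreover have "L2_eq square_M (U s (U' 1 (ftensor \<sigma> f g))) (U' 1 (U s (ftensor \<sigma> f g)))"
      by (intro commute ftensor_L2 \<sigma> f g)
    moreover have "L2_eq square_M (U s (U' 1 (ftensor \<sigma> f g))) (U s (ftensor \<sigma> (W' f) g))"
      by (intro L2_unitary_cong[OF uni] L2_unitary_closed[OF uni'] ftensor_L2 \<sigma> W'L f g U'1)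
    moreover have "L2_eq square_M (U s (ftensor \<sigma> (W' f) g))
        (\<lambda>z. ftensor \<sigma> (shift s (W' f)) g z + ftensor \<sigma> (shift (s - 1) (W' f)) (W g) z)"
      by (intro F.flow_tensor W'L f g s)
    ultimately show ?thesis
      unfolding L2_eq_def by eventually_elim (simp add: A_def ftensor_alt algebra_simps)
  qed
  show ?thesis
  \<comment> \<open>The alternative is decided by whether the commutator with some wrapped shift is
    nonzero.\<close>
  proof (cases "\<exists>s f. f \<in> L2 interval_M \<and> 0 \<le> s \<and> s \<le> 1 \<and> \<not> L2_eq interval_M (A (s - 1) f) (\<lambda>_. 0)")
    case True
    then obtain s f where f: "f \<in> L2 interval_M" and s: "0 \<le> s" "s \<le> 1"
      and B: "\<not> L2_eq interval_M (A (s - 1) f) (\<lambda>_. 0)" by blast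
    let ?c = "L2_inner interval_M (A (s - 1) f) (A (s - 1) f)"
    let ?d = "L2_inner interval_M (A s f) (A (s - 1) f)"
    have c: "?c \<noteq> 0"
      using B L2_norm_eq_0_imp[OF AL[OF f]] by (auto simp: L2_inner_self)
    \<comment> \<open>With \<open>s\<close> and \<open>f\<close> fixed, the quotient is the same for
      every \<open>g\<close>; this uniformity is what makes \<open>W\<close> a scalar.\<close>
    have "L2_eq interval_M (W g) (\<lambda>y. - (?d / ?c) * g y)" if g: "g \<in> L2 interval_M" for g
      using tensor_relation[OF \<sigma> AL[OF f] AL[OF f] g WL[OF g] rel[OF f g s]]
      unfolding L2_eq_def
    proof eventually_elim
      case (elim y)
      then have "?c * W g y = - ?d * g y" by (simp add: add_eq_0_iff2)
      then show ?case using c by (simp add: field_simps)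
    qed
    then show ?thesis unfolding scalar_operator_def by blast
  next
    case False
    have "commutes_periodic_translation W'"
      unfolding commutes_periodic_translation_def
    proof (intro allI ballI)
      fix t :: real and f assume f: "f \<in> L2 interval_M"
      let ?s = "frac t"
      have s: "0 \<le> ?s" "?s < 1" "?s \<le> 1" by (simp_all add: frac_lt_1 less_imp_le)
      have one: "(\<lambda>_. 1) \<in> L2 interval_M" by (intro continuous_L2_interval continuous_intros)
      have B: "L2_eq interval_M (A (?s - 1) f) (\<lambda>_. 0)" using False f s by blast
      \<comment> \<open>Vanishing of the wrapped commutator forces that of the unwrapped one,
        through the relation with \<open>g\<close> = 1.\<close>
      have A: "L2_eq interval_M (A ?s f) (\<lambda>_. 0)"
        by (rule tensor_relation_left[OF \<sigma> AL[OF f] AL[OF f] WL[OF one] rel[OF f one s(1,3)] B])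
      have "L2_eq interval_M (W' (periodic_translation ?s f)) (W' (\<lambda>x. shift ?s f x + shift (?s - 1) f x))"
        by (intro L2_unitary_cong[OF F'.unitary] periodic_translation_shift L2_add shift_L2(1) s f)
      moreover have "L2_eq interval_M (W' (\<lambda>x. shift ?s f x + shift (?s - 1) f x))
          (\<lambda>x. W' (shift ?s f) x + W' (shift (?s - 1) f) x)"
        by (intro L2_unitary_add[OF F'.unitary] shift_L2(1) f)
      moreover have "L2_eq interval_M (periodic_translation ?s (W' f))
          (\<lambda>x. shift ?s (W' f) x + shift (?s - 1) (W' f) x)"
        by (intro periodic_translation_eq_shift s W'L f)
      ultimately have "L2_eq interval_M (W' (periodic_translation ?s f)) (periodic_translation ?s (W' f))"
        using A B unfolding L2_eq_def A_def by eventually_elim simp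
      then show "L2_eq interval_M (W' (periodic_translation t f)) (periodic_translation t (W' f))"
        by (simp only: periodic_translation_frac)
    qed
    then show ?thesis ..
  qed
qed

theorem theorem5p1:
  fixes Ux Uy :: "real \<Rightarrow> (real \<times> real \<Rightarrow> complex) \<Rightarrow> (real \<times> real \<Rightarrow> complex)"
    and Hx Hy :: "(real \<times> real) L2_graph"
    and U2 V1 :: "(real \<Rightarrow> complex) \<Rightarrow> (real \<Rightarrow> complex)"
  assumes Hx: "self_adjoint_extension (1, 0) Hx"
    and Hy: "self_adjoint_extension (0, 1) Hy"
    and Ux: "unitary_group square_M Ux" "generator square_M Ux = Hx"
    and Uy: "unitary_group square_M Uy" "generator square_M Uy = Hy"
    and U2: "boundary_unitary_x Hx U2"
    and V1: "boundary_unitary_y Hy V1"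
    and commute: "\<forall>s t. \<forall>f\<in>L2 square_M. L2_eq square_M (Ux s (Uy t f)) (Uy t (Ux s f))"
  shows "((\<exists>a. scalar_operator U2 a) \<or> commutes_periodic_translation V1) \<and>
    ((\<exists>b. scalar_operator V1 b) \<or> commutes_periodic_translation U2) \<and>
    (\<forall>\<alpha>::real. scalar_operator U2 (exp (\<i> * of_real (2 * pi * \<alpha>))) \<longrightarrow>
      (\<forall>s. \<forall>m::int. \<forall>g\<in>L2 interval_M.
        L2_eq square_M (Ux s (tensor (e (\<alpha> + of_int m)) g))
          (\<lambda>p. exp (\<i> * of_real (2 * pi * (\<alpha> + of_int m) * s)) * tensor (e (\<alpha> + of_int m)) g p))) \<and>
    (\<forall>\<beta>::real. scalar_operator V1 (exp (\<i> * of_real (2 * pi * \<beta>))) \<longrightarrow>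
      (\<forall>t. \<forall>n::int. \<forall>f\<in>L2 interval_M.
        L2_eq square_M (Uy t (tensor f (e (\<beta> + of_int n))))
          (\<lambda>p. exp (\<i> * of_real (2 * pi * (\<beta> + of_int n) * t)) * tensor f (e (\<beta> + of_int n)) p)))"
proof -
  have X: "boundary_flow (\<lambda>p. p) Hx Ux U2"
    by unfold_locales (use Hx Ux U2 in \<open>auto simp: is_flip_def boundary_unitary_x_def\<close>)
  have Y: "boundary_flow prod.swap Hy Uy V1"
    by unfold_locales (use Hy Uy V1 in \<open>auto simp: is_flip_def boundary_unitary_y_def\<close>)
  \<comment> \<open>Both orders of the two flows are brought into the form \<open>\<sigma>\<close>,
    \<open>prod.swap \<circ> \<sigma>\<close>: the identity first for (i), the swap first for
    (ii).\<close>
  have swaps: "prod.swap \<circ> (\<lambda>p. p) = (prod.swap :: real \<times> real \<Rightarrow> _)"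
    "prod.swap \<circ> prod.swap = (\<lambda>p :: real \<times> real. p)"
    by auto
  have X': "boundary_flow (prod.swap \<circ> prod.swap) Hx Ux U2"
    and Y': "boundary_flow (prod.swap \<circ> (\<lambda>p. p)) Hy Uy V1"
    unfolding swaps by (rule X Y)+
  have ftensor_id: "ftensor (\<lambda>p. p) f g = tensor f g" and ftensor_prod_swap: "ftensor prod.swap f g = tensor g f" for f g
    by (auto simp: ftensor_def tensor_def fun_eq_iff)
  show ?thesis
  proof (intro conjI allI impI ballI)
    show "(\<exists>a. scalar_operator U2 a) \<or> commutes_periodic_translation V1"
      by (rule commuting_flows[OF X Y' commute[rule_format]])
    show "(\<exists>b. scalar_operator V1 b) \<or> commutes_periodic_translation U2"
      by (rule commuting_flows[OF Y X' L2_eq_sym[OF commute[rule_format]]])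
  qed (use boundary_flow.flow_eigenvector[OF X] boundary_flow.flow_eigenvector[OF Y] in
      \<open>simp_all only: ftensor_id ftensor_prod_swap\<close>)
qed

end
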